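(* Let $(M,M_+,M_-)$ be an associative triple with diagonal $D$, corresponding to subalgebras $N_+,D,N_-$ of $M$ with $M_\pm=D+N_\pm$. Let $Q=\sum_i\alpha_i\otimes\beta^i\in N_+\otimes N_-\subset M^{\otimes 2}$ be the canonical element with respect to the inner product of $M$, where $\{\alpha_i\}$ is a basis of $N_+$ and $\{\beta^i\}$ is the dual basis of $N_-$. Then: (1) $Q$ satisfies the Yang–Baxter equation in $M^{\otimes 3}$. (2) If $S\in D^{\otimes 2}$ satisfies the Yang–Baxter equation and fulfils the Hecke condition in $D^{\otimes 2}$, then $R=S+Q\in M^{\otimes 2}$ satisfies the Yang–Baxter equation.
   Context: All algebras are finite-dimensional associative algebras over $\mathbb{C}$. $M$ has a unit $1$ and is endowed with a non-degenerate symmetric bilinear form $(\cdot,\cdot)$ (the inner product) that is cyclic: $(xy,z)=(y,zx)$ for all $x,y,z\in M$. Yang–Baxter equation for $R\in M^{\otimes 2}$: $R_{12}R_{13}R_{23}=R_{23}R_{13}R_{12}$ in $M^{\otimes 3}$, where subscripts indicate the tensor factors in which $R$ is placed (with $1$ in the remaining factor). For $R=\sum a\otimes b$, put $R_{21}=\sum b\otimes a$. Associative triple: suppose $M$ is the linear sum $M=N_-+D+N_+$ of three (not necessarily unital) subalgebras such that (i) $N_-$ is dual to $N_+$ with respect to the inner product, i.e. $(\cdot,\cdot)$ restricts to a non-degenerate pairing between $N_+$ and $N_-$; (ii) $N_+$ and $N_-$ are $D$-bimodules under the multiplication of $M$, i.e. $DN_\pm\subset N_\pm$ and $N_\pm D\subset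 N_\pm$; (iii) $D$ is orthogonal to $N_-+N_+$. Put $M_\pm=D+N_\pm$. Then $(M,M_+,M_-)$ is called an associative triple with diagonal $D=M_+\cap M_-$. By (iii) the restriction of $(\cdot,\cdot)$ to $D$ is non-degenerate. The dual basis satisfies $(\alpha_i,\beta^k)=\delta_i^k$. Permutation: for an algebra $A$ with a non-degenerate symmetric cyclic inner product, $\sigma_A=\sum_i a_i\otimes a^i\in A^{\otimes 2}$, where $\{a_i\}$ is a basis of $A$ and $\{a^i\}$ its dual basis, $(a_i,a^k)=\delta_i^k$. In particular $\sigma_D$ is defined using the restriction of the inner product of $M$ to $D$. Hecke condition: $S\in D^{\otimes 2}$ fulfils the Hecke condition in $D^{\otimes 2}$ if $S_{21}S-\sigma_D S=\lambda^2\,1\otimes 1$ for some nonzero $\lambda\in\mathbb{C}$, where $1$ is the unit of $M$ (so $1\in D$). *)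

theory Defs
  imports Complex_Main "HOL-Library.Poly_Mapping"
begin

section \<open>Complex vector spaces and algebras\<close>

class scaleC =
  fixes scaleC :: "complex \<Rightarrow> 'a \<Rightarrow> 'a"  (infixr \<open>*\<^sub>C\<close> 75)

class complex_vector = scaleC + ab_group_add +
  assumes scaleC_add_right: "a *\<^sub>C (x + y) = a *\<^sub>C x + a *\<^sub>C y"
    and scaleC_add_left: "(a + b) *\<^sub>C x = a *\<^sub>C x + b *\<^sub>C x"
    and scaleC_scaleC [simp]: "a *\<^sub>C (b *\<^sub>C x) = (a * b) *\<^sub>C x"
    and scaleC_one [simp]: "1 *\<^sub>C x = x"

global_interpretation complex_vector:
  vector_space "scaleC :: complex \<Rightarrow> 'a \<Rightarrow> 'a::complex_vector"
  by unfold_locales (simp_all add: scaleC_add_right scaleC_add_left)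

class complex_algebra = complex_vector + ring +
  assumes mult_scaleC_left [simp]: "(a *\<^sub>C x) * y = a *\<^sub>C (x * y)"
    and mult_scaleC_right [simp]: "x * (a *\<^sub>C y) = a *\<^sub>C (x * y)"

text \<open>Based on \<^class>\<open>monoid_mult\<close> rather than \<^class>\<open>ring_1\<close>, so that the zero algebra is
  admitted (and no proof of \<open>1 \<noteq> 0\<close> is needed for tensor products).\<close>

class complex_unital_algebra = complex_algebra + monoid_mult

instantiation complex :: complex_vector
begin
definition scaleC_complex :: "complex \<Rightarrow> complex \<Rightarrow> complex" where
  "scaleC_complex = (*)"
instance
  by standard (simp_all add: scaleC_complex_def algebra_simps)
end

instantiation poly_mapping :: (type, complex_vector) complex_vector
begin
lift_definition scaleC_poly_mapping :: "complex \<Rightarrow> ('a \<Rightarrow>\<^sub>0 'b) \<Rightarrow> ('a \<Rightarrow>\<^sub>0 'b)"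
  is "\<lambda>c f x. c *\<^sub>C f x"
  by (erule finite_subset[rotated]) auto
instance
  by standard (transfer; simp add: scaleC_add_right scaleC_add_left fun_eq_iff)+
end

lemma lookup_scaleC [simp]:
  "Poly_Mapping.lookup (c *\<^sub>C p) k = c *\<^sub>C Poly_Mapping.lookup p k"
  by transfer simp

abbreviation complex_linear :: "('a::complex_vector \<Rightarrow> 'b::complex_vector) \<Rightarrow> bool" where
  "complex_linear \<equiv> Vector_Spaces.linear scaleC scaleC"

lemma complex_linear_iff:
  "complex_linear f \<longleftrightarrow> (\<forall>x y. f (x + y) = f x + f y) \<and> (\<forall>c x. f (c *\<^sub>C x) = c *\<^sub>C f x)"
  by (simp add: linear_iff_module_hom module_hom_iff complex_vector.module_axioms)

definition complex_bilinear ::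
  "('a::complex_vector \<Rightarrow> 'b::complex_vector \<Rightarrow> 'c::complex_vector) \<Rightarrow> bool" where
  "complex_bilinear f \<longleftrightarrow> (\<forall>y. complex_linear (\<lambda>x. f x y)) \<and> (\<forall>x. complex_linear (f x))"

lemma complex_bilinear_iff:
  "complex_bilinear f \<longleftrightarrow>
     (\<forall>x x' y. f (x + x') y = f x y + f x' y) \<and> (\<forall>c x y. f (c *\<^sub>C x) y = c *\<^sub>C f x y) \<and>
     (\<forall>x y y'. f x (y + y') = f x y + f x y') \<and> (\<forall>c x y. f x (c *\<^sub>C y) = c *\<^sub>C f x y)"
  by (auto simp: complex_bilinear_def complex_linear_iff)


section \<open>The tensor product of complex vector spaces\<close>

text \<open>The quotient of the free vector space on \<open>'a \<times> 'b\<close> by the bilinearity relations.\<close>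

definition tensor_relators :: "(('a::complex_vector \<times> 'b::complex_vector) \<Rightarrow>\<^sub>0 complex) set" where
  "tensor_relators =
     {Poly_Mapping.single (a + a', b) 1 - Poly_Mapping.single (a, b) 1
        - Poly_Mapping.single (a', b) 1 | a a' b. True} \<union>
     {Poly_Mapping.single (a, b + b') 1 - Poly_Mapping.single (a, b) 1
        - Poly_Mapping.single (a, b') 1 | a b b'. True} \<union>
     {Poly_Mapping.single (c *\<^sub>C a, b) 1 - c *\<^sub>C Poly_Mapping.single (a, b) 1 | c a b. True} \<union>
     {Poly_Mapping.single (a, c *\<^sub>C b) 1 - c *\<^sub>C Poly_Mapping.single (a, b) 1 | c a b. True}"

definition tensor_rel ::
  "(('a::complex_vector \<times> 'b::complex_vector) \<Rightarrow>\<^sub>0 complex) \<Rightarrow> (('a \<times> 'b) \<Rightarrow>\<^sub>0 complex) \<Rightarrow> bool" where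
  "tensor_rel p q \<longleftrightarrow> p - q \<in> complex_vector.span tensor_relators"

lemma equivp_tensor_rel:
  "equivp (tensor_rel :: (('a::complex_vector \<times> 'b::complex_vector) \<Rightarrow>\<^sub>0 complex) \<Rightarrow> _)"
proof (rule equivpI)
  let ?r = "tensor_rel :: ('a \<times> 'b \<Rightarrow>\<^sub>0 complex) \<Rightarrow> _"
  show "reflp ?r"
    by (simp add: reflp_def tensor_rel_def complex_vector.span_zero)
  show "symp ?r"
  proof (rule sympI)
    fix p q :: "('a \<times> 'b) \<Rightarrow>\<^sub>0 complex"
    assume "tensor_rel p q"
    then have "- (p - q) \<in> complex_vector.span tensor_relators"
      unfolding tensor_rel_def by (rule complex_vector.span_neg)
    then show "tensor_rel q p"
      by (simp add: tensor_rel_def)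
  qed
  show "transp ?r"
  proof (rule transpI)
    fix p q r :: "('a \<times> 'b) \<Rightarrow>\<^sub>0 complex"
    assume "tensor_rel p q" "tensor_rel q r"
    then have "(p - q) + (q - r) \<in> complex_vector.span tensor_relators"
      unfolding tensor_rel_def by (rule complex_vector.span_add)
    then show "tensor_rel p r"
      by (simp add: tensor_rel_def)
  qed
qed

quotient_type (overloaded) ('a, 'b) tensor =
  "(('a::complex_vector \<times> 'b::complex_vector) \<Rightarrow>\<^sub>0 complex)" / tensor_rel
  by (rule equivp_tensor_rel)

instantiation tensor :: (complex_vector, complex_vector) complex_vector
begin

lift_definition zero_tensor :: "('a, 'b) tensor" is 0 .

lift_definition plus_tensor :: "('a, 'b) tensor \<Rightarrow> ('a, 'b) tensor \<Rightarrow> ('a, 'b) tensor" is "(+)"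
  unfolding tensor_rel_def by (simp only: add_diff_add complex_vector.span_add)

lift_definition uminus_tensor :: "('a, 'b) tensor \<Rightarrow> ('a, 'b) tensor" is uminus
  unfolding tensor_rel_def by (simp only: minus_diff_minus complex_vector.span_neg)

lift_definition minus_tensor :: "('a, 'b) tensor \<Rightarrow> ('a, 'b) tensor \<Rightarrow> ('a, 'b) tensor" is "(-)"
  unfolding tensor_rel_def
proof -
  fix p p' q q' :: "('a \<times> 'b) \<Rightarrow>\<^sub>0 complex"
  assume "p - p' \<in> complex_vector.span tensor_relators"
    and "q - q' \<in> complex_vector.span tensor_relators"
  then have "(p - p') - (q - q') \<in> complex_vector.span tensor_relators"
    by (rule complex_vector.span_diff)
  then show "p - q - (p' - q') \<in> complex_vector.span tensor_relators"
    by (simp add: algebra_simps)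
qed

lift_definition scaleC_tensor :: "complex \<Rightarrow> ('a, 'b) tensor \<Rightarrow> ('a, 'b) tensor" is scaleC
  unfolding tensor_rel_def
  by (simp only: complex_vector.span_scale complex_vector.scale_right_diff_distrib[symmetric])

instance
  by standard
    (transfer; simp add: tensor_rel_def complex_vector.span_zero algebra_simps)+

end

lift_definition tensor_mk :: "'a::complex_vector \<Rightarrow> 'b::complex_vector \<Rightarrow> ('a, 'b) tensor"
    (infixl \<open>\<otimes>\<close> 73)
  is "\<lambda>a b. Poly_Mapping.single (a, b) 1" .

lemma complex_bilinear_tensor: "complex_bilinear (\<otimes>)"
proof -
  have *: "p = q \<Longrightarrow> p \<in> tensor_relators \<Longrightarrow> q \<in> complex_vector.span tensor_relators"
    for p q :: "('a \<times> 'b) \<Rightarrow>\<^sub>0 complex"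
    by (simp add: complex_vector.span_base)
  show ?thesis
    unfolding complex_bilinear_iff
  proof (intro conjI allI)
    fix x x' :: 'a and y y' :: 'b and c :: complex
    show "(x + x') \<otimes> y = x \<otimes> y + x' \<otimes> y"
      by (transfer, unfold tensor_rel_def, rule *[OF diff_diff_eq])
        (unfold tensor_relators_def, blast)
    show "x \<otimes> (y + y') = x \<otimes> y + x \<otimes> y'"
      by (transfer, unfold tensor_rel_def, rule *[OF diff_diff_eq])
        (unfold tensor_relators_def, blast)
    show "(c *\<^sub>C x) \<otimes> y = c *\<^sub>C (x \<otimes> y)"
      by (transfer, unfold tensor_rel_def, rule *[OF refl]) (unfold tensor_relators_def, blast)
    show "x \<otimes> (c *\<^sub>C y) = c *\<^sub>C (x \<otimes> y)"
      by (transfer, unfold tensor_rel_def, rule *[OF refl]) (unfold tensor_relators_def, blast)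
  qed
qed

lemma
  shows tensor_add_left: "(x + x') \<otimes> y = x \<otimes> y + x' \<otimes> y"
    and tensor_add_right: "x \<otimes> (y + y') = x \<otimes> y + x \<otimes> y'"
    and tensor_scaleC_left: "(c *\<^sub>C x) \<otimes> y = c *\<^sub>C (x \<otimes> y)"
    and tensor_scaleC_right: "x \<otimes> (c *\<^sub>C y) = c *\<^sub>C (x \<otimes> y)"
  using complex_bilinear_tensor unfolding complex_bilinear_iff by blast+

lemma poly_mapping_sum_singles:
  fixes p :: "'k \<Rightarrow>\<^sub>0 complex"
  shows "p = (\<Sum>k\<in>Poly_Mapping.keys p.
           Poly_Mapping.lookup p k *\<^sub>C Poly_Mapping.single k 1)"
proof (rule poly_mapping_eqI)
  fix i
  have "(\<Sum>k\<in>Poly_Mapping.keys p.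
          Poly_Mapping.lookup p k * Poly_Mapping.lookup (Poly_Mapping.single k 1) i) =
        (\<Sum>k\<in>Poly_Mapping.keys p. if k = i then Poly_Mapping.lookup p k else 0)"
    by (rule sum.cong) (auto simp: lookup_single when_def)
  also have "\<dots> = Poly_Mapping.lookup p i"
    by (auto simp: in_keys_iff)
  finally show "Poly_Mapping.lookup p i = Poly_Mapping.lookup
      (\<Sum>k\<in>Poly_Mapping.keys p. Poly_Mapping.lookup p k *\<^sub>C Poly_Mapping.single k 1) i"
    by (simp add: lookup_sum scaleC_complex_def)
qed

lemma tensor_induct [case_names zero pure add, induct type: tensor]:
  fixes t :: "('a::complex_vector, 'b::complex_vector) tensor"
  assumes "P 0" and pure: "\<And>a b. P (a \<otimes> b)" and add: "\<And>u v. P u \<Longrightarrow> P v \<Longrightarrow> P (u + v)"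
  shows "P t"
proof -
  obtain p where t: "t = abs_tensor p"
    by (metis Quotient_abs_rep[OF Quotient_tensor])
  have abs_sum: "abs_tensor (\<Sum>k\<in>K. f k) = (\<Sum>k\<in>K. abs_tensor (f k))"
    for K :: "('a \<times> 'b) set" and f :: "'a \<times> 'b \<Rightarrow> ('a \<times> 'b) \<Rightarrow>\<^sub>0 complex"
    by (induct K rule: infinite_finite_induct)
      (simp_all add: plus_tensor.abs_eq[symmetric] zero_tensor.abs_eq[symmetric])
  have single: "abs_tensor (c *\<^sub>C Poly_Mapping.single k 1) = (c *\<^sub>C fst k) \<otimes> snd k"
    for c and k :: "'a \<times> 'b"
    unfolding tensor_scaleC_left by (simp add: tensor_mk.abs_eq scaleC_tensor.abs_eq)
  have "P (\<Sum>k\<in>K. abs_tensor (Poly_Mapping.lookup p k *\<^sub>C Poly_Mapping.single k 1))" for K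
    by (induct K rule: infinite_finite_induct) (simp_all add: assms single)
  then show ?thesis
    by (metis t abs_sum poly_mapping_sum_singles)
qed

definition free_extend :: "('k \<Rightarrow> 'c::complex_vector) \<Rightarrow> ('k \<Rightarrow>\<^sub>0 complex) \<Rightarrow> 'c" where
  "free_extend f p = (\<Sum>k\<in>Poly_Mapping.keys p. Poly_Mapping.lookup p k *\<^sub>C f k)"

lemma free_extend_superset:
  assumes "finite K" "Poly_Mapping.keys p \<subseteq> K"
  shows "free_extend f p = (\<Sum>k\<in>K. Poly_Mapping.lookup p k *\<^sub>C f k)"
  unfolding free_extend_def using assms
  by (intro sum.mono_neutral_left) (auto simp: in_keys_iff)

lemma free_extend_single [simp]: "free_extend f (Poly_Mapping.single k 1) = f k"
  by (simp add: free_extend_def)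

lemma complex_linear_free_extend: "complex_linear (free_extend f)"
  unfolding complex_linear_iff
proof (intro conjI allI)
  fix p q :: "'a \<Rightarrow>\<^sub>0 complex" and c
  have "finite (Poly_Mapping.keys p \<union> Poly_Mapping.keys q)"
    "Poly_Mapping.keys (p + q) \<subseteq> Poly_Mapping.keys p \<union> Poly_Mapping.keys q"
    by (auto simp: keys_add)
  then show "free_extend f (p + q) = free_extend f p + free_extend f q"
    by (simp add: free_extend_superset[of "Poly_Mapping.keys p \<union> Poly_Mapping.keys q"]
        lookup_add scaleC_add_left        sum.distrib)
  have "Poly_Mapping.keys (c *\<^sub>C p) \<subseteq> Poly_Mapping.keys p"
    by (auto simp: in_keys_iff)
  then show "free_extend f (c *\<^sub>C p) = c *\<^sub>C free_extend f p"
    by (simp add: free_extend_superset[of "Poly_Mapping.keys p"] complex_vector.scale_sum_right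
        scaleC_complex_def)
qed

text \<open>The linear map out of the tensor product that is induced by a bilinear map (universal
  property). The \<open>if\<close> only makes the function total; it is never used for non-bilinear maps.\<close>

lift_definition tensor_lift ::
  "('a::complex_vector \<Rightarrow> 'b::complex_vector \<Rightarrow> 'c::complex_vector) \<Rightarrow> ('a, 'b) tensor \<Rightarrow> 'c"
  is "\<lambda>f p. if complex_bilinear f then free_extend (\<lambda>(a, b). f a b) p else 0"
proof -
  fix f :: "'a \<Rightarrow> 'b \<Rightarrow> 'c" and p q :: "('a \<times> 'b) \<Rightarrow>\<^sub>0 complex"
  assume pq: "tensor_rel p q"
  show "(if complex_bilinear f then free_extend (\<lambda>(a, b). f a b) p else 0) =
        (if complex_bilinear f then free_extend (\<lambda>(a, b). f a b) q else 0)"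
  proof (cases "complex_bilinear f")
    case True
    interpret Vector_Spaces.linear scaleC scaleC "free_extend (\<lambda>(a, b). f a b)"
      by (rule complex_linear_free_extend)
    have "free_extend (\<lambda>(a, b). f a b) r = 0" if "r \<in> tensor_relators" for r
      using that True
      by (auto simp: tensor_relators_def complex_bilinear_iff diff scale)
    then have "free_extend (\<lambda>(a, b). f a b) (p - q) = 0"
      using pq unfolding tensor_rel_def by (metis eq_0_on_span)
    then show ?thesis
      by (simp add: diff)
  qed simp
qed

lemma tensor_lift_pure [simp]: "complex_bilinear f \<Longrightarrow> tensor_lift f (a \<otimes> b) = f a b"
  by transfer simp

lemma complex_linear_tensor_lift: "complex_linear (tensor_lift f)"
  unfolding complex_linear_iff
  by (transfer; use complex_linear_free_extend in \<open>auto simp: complex_linear_iff\<close>)+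

lemma tensor_lift_add [simp]: "tensor_lift f (t + u) = tensor_lift f t + tensor_lift f u"
  and tensor_lift_scaleC [simp]: "tensor_lift f (c *\<^sub>C t) = c *\<^sub>C tensor_lift f t"
  using complex_linear_tensor_lift[of f] unfolding complex_linear_iff by blast+

lemma tensor_lift_zero [simp]: "tensor_lift f 0 = 0"
  using tensor_lift_add[of f 0 0] by simp

section \<open>The tensor product of algebras\<close>

lemma complex_bilinear_mult_pure:
  fixes a :: "'a::complex_unital_algebra" and b :: "'b::complex_unital_algebra"
  shows "complex_bilinear (\<lambda>a' b'. (a * a') \<otimes> (b * b'))"
  by (simp add: complex_bilinear_iff distrib_left tensor_add_left tensor_add_right
      tensor_scaleC_left tensor_scaleC_right)

lemma complex_bilinear_mult_tensor:
  fixes u :: "('a::complex_unital_algebra, 'b::complex_unital_algebra) tensor"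
  shows "complex_bilinear (\<lambda>a b. tensor_lift (\<lambda>a' b'. (a * a') \<otimes> (b * b')) u)"
proof (induct u)
  case zero
  show ?case by (simp add: complex_bilinear_iff)
next
  case (pure x y)
  show ?case
    by (simp add: complex_bilinear_mult_pure)
      (simp add: complex_bilinear_iff distrib_right tensor_add_left tensor_add_right
        tensor_scaleC_left tensor_scaleC_right)
next
  case (add v w)
  then show ?case
    by (simp add: complex_bilinear_iff scaleC_add_right add.assoc add.left_commute)
qed

instantiation tensor :: (complex_unital_algebra, complex_unital_algebra) complex_unital_algebra
begin

definition one_tensor :: "('a, 'b) tensor" where
  "one_tensor = 1 \<otimes> 1"

definition times_tensor :: "('a, 'b) tensor \<Rightarrow> ('a, 'b) tensor \<Rightarrow> ('a, 'b) tensor" where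
  "times_tensor t u = tensor_lift (\<lambda>a b. tensor_lift (\<lambda>a' b'. (a * a') \<otimes> (b * b')) u) t"

instance
proof
  have mult_pure: "(a \<otimes> b) * (a' \<otimes> b') = (a * a') \<otimes> (b * b')" for a a' :: 'a and b b' :: 'b
    unfolding times_tensor_def
    by (rule trans[OF tensor_lift_pure[OF complex_bilinear_mult_tensor]
          tensor_lift_pure[OF complex_bilinear_mult_pure]])
  have pure_left: "(a \<otimes> b) * u = tensor_lift (\<lambda>a' b'. (a * a') \<otimes> (b * b')) u"
    for a :: 'a and b :: 'b and u
    unfolding times_tensor_def
    by (simp only: tensor_lift_pure complex_bilinear_mult_tensor)
  show left: "(r + s) * t = r * t + s * t" for r s t :: "('a, 'b) tensor"
    unfolding times_tensor_def by (rule tensor_lift_add)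
  have zl: "0 * x = 0" for x :: "('a, 'b) tensor"
    unfolding times_tensor_def by (rule tensor_lift_zero)
  show right: "r * (s + t) = r * s + r * t" for r s t :: "('a, 'b) tensor"
  proof (induct r)
    case zero
    show ?case by (simp only: zl add_0_left)
  next
    case (pure a b)
    show ?case by (simp only: pure_left tensor_lift_add)
  next
    case (add u v)
    then show ?case by (simp only: left add.assoc add.left_commute)
  qed
  have zr: "x * 0 = 0" for x :: "('a, 'b) tensor"
    using right[of x 0 0] by simp
  show scl: "(c *\<^sub>C r) * s = c *\<^sub>C (r * s)" for c and r s :: "('a, 'b) tensor"
    unfolding times_tensor_def by (rule tensor_lift_scaleC)
  show "r * (c *\<^sub>C s) = c *\<^sub>C (r * s)" for c and r s :: "('a, 'b) tensor"
  proof (induct r)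
    case zero
    show ?case by (simp only: zl complex_vector.scale_zero_right)
  next
    case (pure a b)
    show ?case by (simp only: pure_left tensor_lift_scaleC)
  next
    case (add u v)
    then show ?case by (simp only: left scaleC_add_right)
  qed
  show "r * s * t = r * (s * t)" for r s t :: "('a, 'b) tensor"
  proof (induct r)
    case zero
    show ?case by (simp only: zl)
  next
    case (pure a b)
    show ?case
    proof (induct s)
      case zero
      show ?case by (simp only: zl zr)
    next
      case (pure a' b')
      show ?case
      proof (induct t)
        case zero
        show ?case by (simp only: zr)
      next
        case (pure a'' b'')
        show ?case by (simp only: \<open>\<And>a a' b b'. (a \<otimes> b) * (a' \<otimes> b') = (a * a') \<otimes> (b * b')\<close> mult.assoc)
      next
        case (add u v)
        then show ?case by (simp only: right)
      qed
    next
      case (add u v)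
      then show ?case by (simp only: left right)
    qed
  next
    case (add u v)
    then show ?case by (simp only: left)
  qed
  show "1 * r = r" for r :: "('a, 'b) tensor"
  proof (induct r)
    case (pure a b)
    show ?case
      unfolding one_tensor_def by (simp only: mult_pure mult_1_left)
  qed (simp_all only: zr right)
  show "r * 1 = r" for r :: "('a, 'b) tensor"
  proof (induct r)
    case (pure a b)
    show ?case
      unfolding one_tensor_def by (simp only: mult_pure mult_1_right)
  qed (simp_all only: zl left)
qed

end

lemma tensor_mult_pure [simp]: "(a \<otimes> b) * (a' \<otimes> b') = (a * a') \<otimes> (b * b')"
  unfolding times_tensor_def
  by (rule trans[OF tensor_lift_pure[OF complex_bilinear_mult_tensor]
      tensor_lift_pure[OF complex_bilinear_mult_pure]])


section \<open>The Yang--Baxter equation\<close>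

text \<open>The triple tensor power is \<open>(M \<otimes> M) \<otimes> M\<close>.\<close>

type_synonym 'a tensor2 = "('a, 'a) tensor"
type_synonym 'a tensor3 = "('a tensor2, 'a) tensor"

definition leg12 :: "'a::complex_unital_algebra tensor2 \<Rightarrow> 'a tensor3" where
  "leg12 = tensor_lift (\<lambda>a b. a \<otimes> b \<otimes> 1)"

definition leg13 :: "'a::complex_unital_algebra tensor2 \<Rightarrow> 'a tensor3" where
  "leg13 = tensor_lift (\<lambda>a b. a \<otimes> 1 \<otimes> b)"

definition leg23 :: "'a::complex_unital_algebra tensor2 \<Rightarrow> 'a tensor3" where
  "leg23 = tensor_lift (\<lambda>a b. 1 \<otimes> a \<otimes> b)"

definition flip :: "'a::complex_vector tensor2 \<Rightarrow> 'a tensor2" where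
  "flip = tensor_lift (\<lambda>a b. b \<otimes> a)"

lemma
  shows leg12_pure [simp]: "leg12 (a \<otimes> b) = a \<otimes> b \<otimes> 1"
    and leg13_pure [simp]: "leg13 (a \<otimes> b) = a \<otimes> 1 \<otimes> b"
    and leg23_pure [simp]: "leg23 (a \<otimes> b) = 1 \<otimes> a \<otimes> b"
    and flip_pure [simp]: "flip (a \<otimes> b) = b \<otimes> a"
  unfolding leg12_def leg13_def leg23_def flip_def
  by (subst tensor_lift_pure;
      simp add: complex_bilinear_iff tensor_add_left tensor_add_right
        tensor_scaleC_left tensor_scaleC_right)+

definition yang_baxter :: "'a::complex_unital_algebra tensor2 \<Rightarrow> bool" where
  "yang_baxter R \<longleftrightarrow> leg12 R * leg13 R * leg23 R = leg23 R * leg13 R * leg12 R"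


section \<open>Associative triples\<close>

definition is_subalgebra :: "'a::complex_algebra set \<Rightarrow> bool" where
  "is_subalgebra A \<longleftrightarrow> complex_vector.subspace A \<and> (\<forall>x\<in>A. \<forall>y\<in>A. x * y \<in> A)"

locale cyclic_inner_product =
  fixes ip :: "'a::complex_unital_algebra \<Rightarrow> 'a \<Rightarrow> complex"
  assumes bilinear: "complex_bilinear ip"
    and symmetric: "ip x y = ip y x"
    and nondegenerate: "(\<And>y. ip x y = 0) \<Longrightarrow> x = 0"
    and cyclic: "ip (x * y) z = ip y (z * x)"

definition nondegenerate_pairing :: "('a::zero \<Rightarrow> 'a \<Rightarrow> complex) \<Rightarrow> 'a set \<Rightarrow> 'a set \<Rightarrow> bool" where
  "nondegenerate_pairing ip V W \<longleftrightarrow>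
     (\<forall>v\<in>V. (\<forall>w\<in>W. ip v w = 0) \<longrightarrow> v = 0) \<and> (\<forall>w\<in>W. (\<forall>v\<in>V. ip v w = 0) \<longrightarrow> w = 0)"

text \<open>The sum \<open>M = N\<^sub>- + D + N\<^sub>+\<close> is not assumed to be direct, \<open>N\<^sub>+\<close> and \<open>N\<^sub>-\<close> are not assumed
  to be isotropic, and the unit of \<open>M\<close> need not lie in \<open>D\<close>. Example with \<open>1 \<notin> D\<close>:
  \<open>M = \<complex>[\<epsilon>]/(\<epsilon>\<^sup>2)\<close> with \<open>(1, \<epsilon>) = 1\<close> and \<open>(1, 1) = (\<epsilon>, \<epsilon>) = 0\<close>, where \<open>N\<^sub>+ = \<complex>\<epsilon>\<close>,
  \<open>N\<^sub>- = \<complex>1\<close> and \<open>D = 0\<close>. The Hecke condition below forces \<open>1 \<in> D\<close>.\<close>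

locale associative_triple = cyclic_inner_product ip
  for ip :: "'a::complex_unital_algebra \<Rightarrow> 'a \<Rightarrow> complex" +
  fixes Mp Mm Np D Nm :: "'a set"
  assumes finite_dimensional: "\<exists>X::'a set. finite X \<and> complex_vector.span X = UNIV"
    and subalgebra_Np: "is_subalgebra Np"
    and subalgebra_D: "is_subalgebra D"
    and subalgebra_Nm: "is_subalgebra Nm"
    and linear_sum: "(UNIV :: 'a set) = {x + d + y | x d y. x \<in> Nm \<and> d \<in> D \<and> y \<in> Np}"
    and dual: "nondegenerate_pairing ip Np Nm"
    and bimodule_Np: "\<And>d x. d \<in> D \<Longrightarrow> x \<in> Np \<Longrightarrow> d * x \<in> Np \<and> x * d \<in> Np"
    and bimodule_Nm: "\<And>d x. d \<in> D \<Longrightarrow> x \<in> Nm \<Longrightarrow> d * x \<in> Nm \<and> x * d \<in> Nm"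
    and orthogonal: "\<And>d x y. d \<in> D \<Longrightarrow> x \<in> Nm \<Longrightarrow> y \<in> Np \<Longrightarrow> ip d (x + y) = 0"
    and Mp_eq: "Mp = {d + x | d x. d \<in> D \<and> x \<in> Np}"
    and Mm_eq: "Mm = {d + x | d x. d \<in> D \<and> x \<in> Nm}"


section \<open>Canonical elements and the Hecke condition\<close>

definition is_basis :: "'a::complex_vector set \<Rightarrow> 'a set \<Rightarrow> bool" where
  "is_basis A V \<longleftrightarrow> finite A \<and> complex_vector.independent A \<and> complex_vector.span A = V"

text \<open>A basis is given as a set \<open>A\<close>, the dual basis as the family \<open>(\<beta> a)\<close> indexed by \<open>a \<in> A\<close>.\<close>

definition dual_bases ::
  "('a::complex_vector \<Rightarrow> 'a \<Rightarrow> complex) \<Rightarrow> 'a set \<Rightarrow> 'a set \<Rightarrow> 'a set \<Rightarrow> ('a \<Rightarrow> 'a) \<Rightarrow> bool" where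
  "dual_bases ip V W A \<beta> \<longleftrightarrow> is_basis A V \<and> is_basis (\<beta> ` A) W \<and>
     (\<forall>a\<in>A. \<forall>a'\<in>A. ip a (\<beta> a') = (if a = a' then 1 else 0))"

definition permutation :: "('a::complex_vector \<Rightarrow> 'a \<Rightarrow> complex) \<Rightarrow> 'a set \<Rightarrow> 'a tensor2" where
  "permutation ip V = (THE s. \<exists>A \<beta>. dual_bases ip V V A \<beta> \<and> s = (\<Sum>a\<in>A. a \<otimes> \<beta> a))"

text \<open>The element \<open>\<Sum>a\<in>A. a \<otimes> \<beta> a\<close> does not depend on the chosen basis, so the description in
  \<^const>\<open>permutation\<close> is unique.\<close>

lemma dual_bases_expand:
  assumes bil: "complex_bilinear ip" and dual: "dual_bases ip V W A \<beta>"
  shows "v \<in> V \<Longrightarrow> v = (\<Sum>a\<in>A. ip v (\<beta> a) *\<^sub>C a)"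
    and "w \<in> W \<Longrightarrow> w = (\<Sum>a\<in>A. ip a w *\<^sub>C \<beta> a)"
proof -
  have fin: "finite A" and V: "complex_vector.span A = V"
    and W: "complex_vector.span (\<beta> ` A) = W"
    and delta: "\<And>a a'. a \<in> A \<Longrightarrow> a' \<in> A \<Longrightarrow> ip a (\<beta> a') = (if a = a' then 1 else 0)"
    using dual by (auto simp: dual_bases_def is_basis_def)
  have zero: "ip 0 y = 0" "ip y 0 = 0" for y
    using bil unfolding complex_bilinear_iff by (metis add_cancel_right_right)+
  show "v \<in> V \<Longrightarrow> v = (\<Sum>a\<in>A. ip v (\<beta> a) *\<^sub>C a)"
    unfolding V[symmetric]
  proof (induct rule: complex_vector.span_induct_alt)
    case base
    then show ?case by (simp add: zero)
  next
    case (step c x y)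
    have "(\<Sum>a\<in>A. ip x (\<beta> a) *\<^sub>C a) = (\<Sum>a\<in>A. if a = x then a else 0)"
      using step by (intro sum.cong) (auto simp: delta)
    also have "\<dots> = x"
      using step fin by simp
    finally have "x = (\<Sum>a\<in>A. ip x (\<beta> a) *\<^sub>C a)" ..
    then have "c *\<^sub>C x + y = c *\<^sub>C (\<Sum>a\<in>A. ip x (\<beta> a) *\<^sub>C a) + (\<Sum>a\<in>A. ip y (\<beta> a) *\<^sub>C a)"
      by (intro arg_cong2[where f = "(+)"] arg_cong[where f = "scaleC c"] step(2))
    also have "\<dots> = (\<Sum>a\<in>A. ip (c *\<^sub>C x + y) (\<beta> a) *\<^sub>C a)"
      using bil
      by (simp add: complex_bilinear_iff scaleC_add_left sum.distrib
          complex_vector.scale_sum_right scaleC_complex_def)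
    finally show ?case .
  qed
  show "w \<in> W \<Longrightarrow> w = (\<Sum>a\<in>A. ip a w *\<^sub>C \<beta> a)"
    unfolding W[symmetric]
  proof (induct rule: complex_vector.span_induct_alt)
    case base
    then show ?case by (simp add: zero)
  next
    case (step c x y)
    then obtain a' where a': "a' \<in> A" "x = \<beta> a'" by blast
    have "(\<Sum>a\<in>A. ip a x *\<^sub>C \<beta> a) = (\<Sum>a\<in>A. if a = a' then \<beta> a else 0)"
      using a' by (intro sum.cong) (auto simp: delta)
    also have "\<dots> = x"
      using a' fin by simp
    finally have "x = (\<Sum>a\<in>A. ip a x *\<^sub>C \<beta> a)" ..
    then have "c *\<^sub>C x + y = c *\<^sub>C (\<Sum>a\<in>A. ip a x *\<^sub>C \<beta> a) + (\<Sum>a\<in>A. ip a y *\<^sub>C \<beta> a)"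
      by (intro arg_cong2[where f = "(+)"] arg_cong[where f = "scaleC c"] step(2))
    also have "\<dots> = (\<Sum>a\<in>A. ip a (c *\<^sub>C x + y) *\<^sub>C \<beta> a)"
      using bil
      by (simp add: complex_bilinear_iff scaleC_add_left sum.distrib
          complex_vector.scale_sum_right scaleC_complex_def)
    finally show ?case .
  qed
qed

lemma tensor_sum_left: "(\<Sum>i\<in>I. f i) \<otimes> y = (\<Sum>i\<in>I. f i \<otimes> y)"
  and tensor_sum_right: "x \<otimes> (\<Sum>i\<in>I. g i) = (\<Sum>i\<in>I. x \<otimes> g i)"
proof -
  have "0 \<otimes> y = 0" "x \<otimes> 0 = 0"
    using tensor_add_left[of 0 0 y] tensor_add_right[of x 0 0] by simp_all
  then show "(\<Sum>i\<in>I. f i) \<otimes> y = (\<Sum>i\<in>I. f i \<otimes> y)"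
    and "x \<otimes> (\<Sum>i\<in>I. g i) = (\<Sum>i\<in>I. x \<otimes> g i)"
    by (induct I rule: infinite_finite_induct) (simp_all add: tensor_add_left tensor_add_right)
qed

lemma canonical_element_unique:
  assumes "complex_bilinear ip" "dual_bases ip V W A \<beta>" "dual_bases ip V W A' \<beta>'"
  shows "(\<Sum>a\<in>A. a \<otimes> \<beta> a) = (\<Sum>a\<in>A'. a \<otimes> \<beta>' a)"
proof -
  have "\<beta> a \<in> W" if "a \<in> A" for a
    using assms(2) that complex_vector.span_base[of "\<beta> a" "\<beta> ` A"]
    by (auto simp: dual_bases_def is_basis_def)
  then have \<beta>: "\<beta> a = (\<Sum>a'\<in>A'. ip a' (\<beta> a) *\<^sub>C \<beta>' a')" if "a \<in> A" for a
    using dual_bases_expand(2)[OF assms(1,3)] that by blast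
  have "a' \<in> V" if "a' \<in> A'" for a'
    using assms(3) that complex_vector.span_base[of a' A']
    by (auto simp: dual_bases_def is_basis_def)
  then have a': "a' = (\<Sum>a\<in>A. ip a' (\<beta> a) *\<^sub>C a)" if "a' \<in> A'" for a'
    using dual_bases_expand(1)[OF assms(1,2)] that by blast
  have "(\<Sum>a\<in>A. a \<otimes> \<beta> a) = (\<Sum>a\<in>A. a \<otimes> (\<Sum>a'\<in>A'. ip a' (\<beta> a) *\<^sub>C \<beta>' a'))"
    by (intro sum.cong refl arg_cong2[where f = tensor_mk] \<beta>)
  also have "\<dots> = (\<Sum>a'\<in>A'. (\<Sum>a\<in>A. ip a' (\<beta> a) *\<^sub>C a) \<otimes> \<beta>' a')"
    unfolding tensor_sum_left tensor_sum_right tensor_scaleC_left tensor_scaleC_right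
    by (rule sum.swap)
  also have "\<dots> = (\<Sum>a'\<in>A'. a' \<otimes> \<beta>' a')"
    by (intro sum.cong refl arg_cong2[where f = tensor_mk] a'[symmetric])
  finally show ?thesis .
qed

lemma permutation_eq:
  assumes "complex_bilinear ip" "dual_bases ip V V A \<beta>"
  shows "permutation ip V = (\<Sum>a\<in>A. a \<otimes> \<beta> a)"
  unfolding permutation_def
  using assms by (blast intro: the_equality canonical_element_unique)

text \<open>\<open>D \<otimes> D\<close>, as a subspace of \<open>M \<otimes> M\<close>.\<close>

definition tensor_square :: "'a::complex_vector set \<Rightarrow> 'a tensor2 set" where
  "tensor_square D = complex_vector.span {a \<otimes> b | a b. a \<in> D \<and> b \<in> D}"

definition hecke_condition ::
  "('a::complex_unital_algebra \<Rightarrow> 'a \<Rightarrow> complex) \<Rightarrow> 'a set \<Rightarrow> 'a tensor2 \<Rightarrow> bool" where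
  "hecke_condition ip D S \<longleftrightarrow>
     (\<exists>l::complex. l \<noteq> 0 \<and> flip S * S - permutation ip D * S = l\<^sup>2 *\<^sub>C (1 \<otimes> 1))"

end

theory Submission
  imports Defs
begin

text \<open>Write \<open>T\<^sub>l\<close> for pairing the middle factor of \<open>M \<otimes> M \<otimes> M\<close> with \<open>l\<close>. As \<open>N\<^sub>-\<close>, \<open>D\<close>, \<open>N\<^sub>+\<close> span
  \<open>M\<close>, equality in the triple tensor power may be tested by \<open>T\<^sub>l\<close> with \<open>l\<close> in one of the three parts,
  where cyclicity and the bimodule property let one evaluate the sum over one pair of dual
  bases. This proves the Yang--Baxter equation for \<open>Q\<close>.
  The Hecke condition forces \<open>1 \<bottom> N\<^sub>+ + N\<^sub>-\<close>, hence isotropy, and then the same test gives, with \<open>\<sigma> = \<sigma>\<^sub>D\<close>,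
  \<open>Q\<^sub>1\<^sub>2 Q\<^sub>2\<^sub>3 = Q\<^sub>1\<^sub>3 Q\<^sub>1\<^sub>2 + Q\<^sub>2\<^sub>3 Q\<^sub>1\<^sub>3 + Q\<^sub>1\<^sub>3 \<sigma>\<^sub>1\<^sub>2\<close> and
  \<open>Q\<^sub>2\<^sub>3 Q\<^sub>1\<^sub>2 = Q\<^sub>1\<^sub>2 Q\<^sub>1\<^sub>3 + Q\<^sub>1\<^sub>3 Q\<^sub>2\<^sub>3 + \<sigma>\<^sub>1\<^sub>2 Q\<^sub>1\<^sub>3\<close>.
  Elements of \<open>D\<close> pass through \<open>Q\<close> from one factor to the other, so in the expansion of the equation
  for \<open>S + Q\<close> all \<open>S\<close> can be moved to the left of all \<open>Q\<close>. What does not cancel is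
  \<open>(S\<^sub>1\<^sub>2 S\<^sub>2\<^sub>1 - S\<^sub>1\<^sub>2 \<sigma>\<^sub>1\<^sub>2 - S\<^sub>2\<^sub>3 S\<^sub>3\<^sub>2 + S\<^sub>2\<^sub>3 \<sigma>\<^sub>2\<^sub>3) Q\<^sub>1\<^sub>3\<close>, which vanishes by the Hecke condition.\<close>

section \<open>Linearity of the structure maps\<close>

lemma tensor_zero [simp]: "0 \<otimes> y = 0" "x \<otimes> 0 = 0"
  using tensor_add_left[of 0 0 y] tensor_add_right[of x 0 0] by simp_all

lemmas leg_defs = leg12_def leg13_def leg23_def flip_def

lemma leg_add:
  "leg12 (s + t) = leg12 s + leg12 t" "leg13 (s + t) = leg13 s + leg13 t"
  "leg23 (s + t) = leg23 s + leg23 t" "flip (u + v) = flip u + flip v"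
  by (simp_all add: leg_defs)

lemma leg_scaleC:
  "leg12 (c *\<^sub>C t) = c *\<^sub>C leg12 t" "leg13 (c *\<^sub>C t) = c *\<^sub>C leg13 t"
  "leg23 (c *\<^sub>C t) = c *\<^sub>C leg23 t" "flip (c *\<^sub>C u) = c *\<^sub>C flip u"
  by (simp_all add: leg_defs)

lemma leg_zero [simp]: "leg12 0 = 0" "leg13 0 = 0" "leg23 0 = 0" "flip 0 = 0"
  by (simp_all add: leg_defs)

lemma leg_sum:
  "leg12 (\<Sum>i\<in>I. f i) = (\<Sum>i\<in>I. leg12 (f i))"
  "leg13 (\<Sum>i\<in>I. f i) = (\<Sum>i\<in>I. leg13 (f i))"
  "leg23 (\<Sum>i\<in>I. f i) = (\<Sum>i\<in>I. leg23 (f i))"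
  "flip (\<Sum>i\<in>I. g i) = (\<Sum>i\<in>I. flip (g i))"
  by (induct I rule: infinite_finite_induct; simp add: leg_add)+

text \<open>That legs 12 and 23 are algebra maps allows the Hecke condition to be transported to
  both pairs of neighbouring factors.\<close>

lemma leg12_mult: "leg12 (s * t) = leg12 s * leg12 t"
proof (induct s)
  case (pure a b)
  show ?case by (induct t) (simp_all add: leg_add distrib_left)
qed (simp_all add: leg_add distrib_right)

lemma leg23_mult: "leg23 (s * t) = leg23 s * leg23 t"
proof (induct s)
  case (pure a b)
  show ?case by (induct t) (simp_all add: leg_add distrib_left)
qed (simp_all add: leg_add distrib_right)

lemma flip_mult: "flip (s * t) = flip s * flip t"
proof (induct s)
  case (pure a b)
  show ?case by (induct t) (simp_all add: leg_add distrib_left)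
qed (simp_all add: leg_add distrib_right)

lemma flip_flip [simp]: "flip (flip t) = (t :: 'a::complex_unital_algebra tensor2)"
  by (induct t) (simp_all add: leg_add)

lemma leg_one [simp]: "leg12 (1 \<otimes> 1) = 1" "leg23 (1 \<otimes> 1) = 1"
  by (simp_all add: one_tensor_def)

section \<open>Dual bases\<close>

context cyclic_inner_product
begin

lemma ip_add: "ip (x + y) z = ip x z + ip y z" "ip z (x + y) = ip z x + ip z y"
  and ip_scaleC: "ip (c *\<^sub>C x) z = c * ip x z" "ip z (c *\<^sub>C x) = c * ip z x"
  using bilinear unfolding complex_bilinear_iff scaleC_complex_def by blast+

lemma ip_zero [simp]: "ip 0 x = 0" "ip x 0 = 0"
  using ip_add(1)[of 0 0 x] ip_add(2)[of x 0 0] by simp_all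

lemma ip_diff: "ip (x - y) z = ip x z - ip y z" "ip z (x - y) = ip z x - ip z y"
  using ip_add(1)[of "x - y" y z] ip_add(2)[of z "x - y" y] by simp_all

lemma ip_sum: "ip (\<Sum>i\<in>I. f i) z = (\<Sum>i\<in>I. ip (f i) z)" "ip z (\<Sum>i\<in>I. f i) = (\<Sum>i\<in>I. ip z (f i))"
  by (induct I rule: infinite_finite_induct; simp add: ip_add)+

lemma ip_assoc: "ip (x * y) z = ip x (y * z)"
  by (metis cyclic symmetric)

text \<open>Gram-Schmidt for a pairing. Keeping \<open>W\<close> apart from \<open>span B\<close>
  makes the induction work: nondegeneracy is asked only on the side of \<open>span B\<close>, so it
  passes to subsets of \<open>B\<close>, even if the form is degenerate on their span.\<close>

lemma dual_family_exists:
  assumes "finite B" "complex_vector.independent B" "complex_vector.subspace W"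
    and "\<And>v. v \<in> complex_vector.span B \<Longrightarrow> (\<And>w. w \<in> W \<Longrightarrow> ip v w = 0) \<Longrightarrow> v = 0"
  shows "\<exists>\<gamma>. \<forall>b\<in>B. \<gamma> b \<in> W \<and> (\<forall>b'\<in>B. ip b' (\<gamma> b) = (if b' = b then 1 else 0))"
  using assms(1,2,4)
proof (induct B)
  case empty
  then show ?case by simp
next
  case (insert b B)
  have sub: "complex_vector.span B \<subseteq> complex_vector.span (insert b B)"
    by (intro complex_vector.span_mono) auto
  have ind: "complex_vector.independent B"
    by (rule complex_vector.independent_mono[OF insert.prems(1)]) auto
  obtain \<gamma> where \<gamma>: "\<And>c. c \<in> B \<Longrightarrow> \<gamma> c \<in> W"
      "\<And>c c'. c \<in> B \<Longrightarrow> c' \<in> B \<Longrightarrow> ip c' (\<gamma> c) = (if c' = c then 1 else 0)"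
  proof -
    have "\<exists>\<gamma>. \<forall>c\<in>B. \<gamma> c \<in> W \<and> (\<forall>c'\<in>B. ip c' (\<gamma> c) = (if c' = c then 1 else 0))"
      by (rule insert.hyps(3)[OF ind]) (use insert.prems(2) sub in auto)
    with that show thesis by metis
  qed
  \<comment> \<open>\<open>v\<close> is \<open>b\<close> made orthogonal to every
    \<open>\<gamma> c\<close>; it is nonzero because \<open>b\<close> is not in
    \<open>span B\<close>, which yields \<open>w\<close>.\<close>
  define v where "v = b - (\<Sum>c\<in>B. ip b (\<gamma> c) *\<^sub>C c)"
  have s: "(\<Sum>c\<in>B. ip b (\<gamma> c) *\<^sub>C c) \<in> complex_vector.span B"
    by (intro complex_vector.span_sum complex_vector.span_scale complex_vector.span_base)
  have "b \<notin> complex_vector.span B"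
    using insert.prems(1) insert.hyps(2) by (simp add: complex_vector.independent_insert)
  with s have "v \<noteq> 0" by (auto simp: v_def)
  moreover have "v \<in> complex_vector.span (insert b B)"
    unfolding v_def using s sub
    by (intro complex_vector.span_diff) (auto intro: complex_vector.span_base)
  ultimately obtain w where w: "w \<in> W" "ip v w \<noteq> 0"
    using insert.prems(2)[of v] by auto
  \<comment> \<open>The subtraction makes \<open>w\<close> orthogonal to \<open>B\<close> and keeps
    its pairing with \<open>v\<close>; dividing by that value gives the dual vector of
    \<open>b\<close>.\<close>
  define u where "u = inverse (ip v w) *\<^sub>C (w - (\<Sum>c\<in>B. ip c w *\<^sub>C \<gamma> c))"
  have uW: "u \<in> W"
    unfolding u_def
    by (intro complex_vector.subspace_scale complex_vector.subspace_diff
        complex_vector.subspace_sum assms(3) w \<gamma>)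
  have "ip b (w - (\<Sum>c\<in>B. ip c w *\<^sub>C \<gamma> c)) = ip v w"
    by (simp add: v_def ip_diff ip_sum ip_scaleC mult.commute)
  then have bu: "ip b u = 1"
    using w(2) by (simp add: u_def ip_scaleC)
  have cu: "ip c u = 0" if "c \<in> B" for c
  proof -
    have "(\<Sum>c'\<in>B. ip c' w * ip c (\<gamma> c')) = (\<Sum>c'\<in>B. if c' = c then ip c' w else 0)"
      using that by (intro sum.cong) (auto simp: \<gamma>(2))
    also have "\<dots> = ip c w" using that insert.hyps(1) by simp
    finally show ?thesis by (simp add: u_def ip_diff ip_sum ip_scaleC)
  qed
  \<comment> \<open>As \<open>u\<close> pairs to zero with \<open>B\<close>, subtracting multiples
    of it corrects the old dual vectors at \<open>b\<close> alone.\<close>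
  define \<gamma>' where "\<gamma>' c = (if c = b then u else \<gamma> c - ip b (\<gamma> c) *\<^sub>C u)" for c
  have "\<gamma>' c \<in> W" if "c \<in> insert b B" for c
  proof (cases "c = b")
    case False
    then have "\<gamma> c - ip b (\<gamma> c) *\<^sub>C u \<in> W"
      using that by (intro complex_vector.subspace_diff complex_vector.subspace_scale assms(3) uW \<gamma>(1)) simp
    with False show ?thesis by (simp add: \<gamma>'_def)
  qed (simp add: \<gamma>'_def uW)
  moreover have "ip c' (\<gamma>' c) = (if c' = c then 1 else 0)"
    if "c \<in> insert b B" "c' \<in> insert b B" for c c'
    using that insert.hyps(2) by (auto simp: \<gamma>'_def bu cu \<gamma>(2) ip_diff ip_scaleC)
  ultimately show ?case by (intro exI[of _ \<gamma>'] ballI conjI) simp_all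
qed

lemma dual_bases_exist:
  assumes fin: "finite X" "V \<subseteq> complex_vector.span X" and V: "complex_vector.subspace V"
    and nondeg: "\<And>v. v \<in> V \<Longrightarrow> (\<And>w. w \<in> V \<Longrightarrow> ip v w = 0) \<Longrightarrow> v = 0"
  shows "\<exists>B \<gamma>. dual_bases ip V V B \<gamma>"
proof -
  obtain B where B: "B \<subseteq> V" "complex_vector.independent B" "V \<subseteq> complex_vector.span B"
    by (metis complex_vector.maximal_independent_subset)
  have span: "complex_vector.span B = V"
    using B V complex_vector.span_subspace by blast
  have finB: "finite B"
    using complex_vector.independent_span_bound[OF fin(1) B(2)] B(1) fin(2) by auto
  obtain \<gamma> where \<gamma>: "\<And>b. b \<in> B \<Longrightarrow> \<gamma> b \<in> V"
      "\<And>b b'. b \<in> B \<Longrightarrow> b' \<in> B \<Longrightarrow> ip b' (\<gamma> b) = (if b' = b then 1 else 0)"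
  proof -
    have "\<exists>\<gamma>. \<forall>b\<in>B. \<gamma> b \<in> V \<and> (\<forall>b'\<in>B. ip b' (\<gamma> b) = (if b' = b then 1 else 0))"
      by (rule dual_family_exists[OF finB B(2) V]) (use nondeg span in auto)
    with that show thesis by metis
  qed
  have "w \<in> complex_vector.span (\<gamma> ` B)" if w: "w \<in> V" for w
  proof -
    \<comment> \<open>The remainder of the dual expansion is orthogonal to \<open>B\<close>, hence
      to \<open>V\<close>, and so vanishes.\<close>
    let ?u = "w - (\<Sum>b\<in>B. ip b w *\<^sub>C \<gamma> b)"
    have uV: "?u \<in> V"
      by (intro complex_vector.subspace_scale complex_vector.subspace_diff
        complex_vector.subspace_sum V w \<gamma>)
    have *: "ip b ?u = 0" if "b \<in> B" for b
    proof -
      have "(\<Sum>c\<in>B. ip c w * ip b (\<gamma> c)) = (\<Sum>c\<in>B. if c = b then ip c w else 0)"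
        using that by (intro sum.cong) (auto simp: \<gamma>(2))
      also have "\<dots> = ip b w" using that finB by simp
      finally show ?thesis by (simp add: ip_diff ip_sum ip_scaleC)
    qed
    have "ip v ?u = 0" if "v \<in> complex_vector.span B" for v
      using that
    proof (induct rule: complex_vector.span_induct_alt)
      case base
      show ?case by simp
    next
      case (step c x y)
      then show ?case by (simp add: ip_add ip_scaleC *)
    qed
    then have "?u = 0" using nondeg[OF uV] span by (auto simp: symmetric[of ?u])
    then have "w = (\<Sum>b\<in>B. ip b w *\<^sub>C \<gamma> b)" by simp
    also have "\<dots> \<in> complex_vector.span (\<gamma> ` B)"
      by (intro complex_vector.span_sum complex_vector.span_scale complex_vector.span_base imageI)
    finally show ?thesis .
  qed
  moreover have "complex_vector.span (\<gamma> ` B) \<subseteq> V"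
    using \<gamma>(1) V by (intro complex_vector.span_minimal) auto
  ultimately have span': "complex_vector.span (\<gamma> ` B) = V" by blast
  have inj: "inj_on \<gamma> B"
    using \<gamma>(2) by (intro inj_onI) (metis zero_neq_one)
  have "complex_vector.independent (\<gamma> ` B)"
  proof (rule complex_vector.independent_if_scalars_zero)
    fix f x
    assume z: "(\<Sum>x\<in>\<gamma> ` B. f x *\<^sub>C x) = 0" and "x \<in> \<gamma> ` B"
    then obtain b where b: "b \<in> B" "x = \<gamma> b" by blast
    have "0 = ip b (\<Sum>c\<in>B. f (\<gamma> c) *\<^sub>C \<gamma> c)"
      using z inj by (simp add: sum.reindex)
    also have "\<dots> = (\<Sum>c\<in>B. if c = b then f (\<gamma> c) else 0)"
      unfolding ip_sum ip_scaleC using b by (intro sum.cong) (auto simp: \<gamma>(2))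
    also have "\<dots> = f x" using b finB by simp
    finally show "f x = 0" by simp
  qed (use finB in auto)
  then show ?thesis
    using finB B(2) span span' \<gamma>(2)
    by (intro exI[of _ B] exI[of _ \<gamma>]) (auto simp: dual_bases_def is_basis_def)
qed

text \<open>Read from left to right this removes a sum over one pair of dual bases; the contractions
  below are evaluated in this way.\<close>

lemma dual_bases_sum:
  assumes "dual_bases ip V W B \<gamma>" "complex_linear f"
  shows "v \<in> V \<Longrightarrow> (\<Sum>b\<in>B. ip v (\<gamma> b) *\<^sub>C f b) = f v"
    and "w \<in> W \<Longrightarrow> (\<Sum>b\<in>B. ip b w *\<^sub>C f (\<gamma> b)) = f w"
proof -
  interpret f: Vector_Spaces.linear scaleC scaleC f by fact
  show "(\<Sum>b\<in>B. ip v (\<gamma> b) *\<^sub>C f b) = f v" if "v \<in> V"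
    using arg_cong[where f = f, OF dual_bases_expand(1)[OF bilinear assms(1) that]]
    by (simp add: f.sum f.scale)
  show "(\<Sum>b\<in>B. ip b w *\<^sub>C f (\<gamma> b)) = f w" if "w \<in> W"
    using arg_cong[where f = f, OF dual_bases_expand(2)[OF bilinear assms(1) that]]
    by (simp add: f.sum f.scale)
qed

lemma dual_bases_mem:
  assumes "dual_bases ip V W B \<gamma>" "b \<in> B"
  shows "b \<in> V" "\<gamma> b \<in> W"
  using assms by (auto simp: dual_bases_def is_basis_def intro: complex_vector.span_base)

lemma tensor_linear:
  "complex_linear (\<lambda>x. x \<otimes> y)" "complex_linear (\<lambda>y. x \<otimes> y)"
  by (simp_all add: complex_linear_iff tensor_add_left tensor_add_right
      tensor_scaleC_left tensor_scaleC_right)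

text \<open>Right multiplication by \<open>d\<close> on \<open>V\<close> is adjoint to left
  multiplication by \<open>d\<close> on \<open>W\<close>, so their matrices in the dual bases are
  transposes of each other.\<close>

lemma canonical_slide_left:
  assumes dual: "dual_bases ip V W B \<gamma>"
    and V: "\<And>v. v \<in> V \<Longrightarrow> v * d \<in> V" and W: "\<And>w. w \<in> W \<Longrightarrow> d * w \<in> W"
  shows "(\<Sum>b\<in>B. (b * d) \<otimes> \<gamma> b) = (\<Sum>b\<in>B. b \<otimes> (d * \<gamma> b))"
proof -
  have "(\<Sum>b\<in>B. (b * d) \<otimes> \<gamma> b) = (\<Sum>b\<in>B. \<Sum>c\<in>B. ip (b * d) (\<gamma> c) *\<^sub>C (c \<otimes> \<gamma> b))"
    by (intro sum.cong) (simp_all add: dual_bases_sum(1)[OF dual tensor_linear(1)] V dual_bases_mem[OF dual])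
  also have "\<dots> = (\<Sum>c\<in>B. \<Sum>b\<in>B. ip b (d * \<gamma> c) *\<^sub>C (c \<otimes> \<gamma> b))"
    unfolding ip_assoc by (rule sum.swap)
  also have "\<dots> = (\<Sum>c\<in>B. c \<otimes> (d * \<gamma> c))"
    by (intro sum.cong) (simp_all add: dual_bases_sum(2)[OF dual tensor_linear(2)] W dual_bases_mem[OF dual])
  finally show ?thesis .
qed

text \<open>Here left multiplication on \<open>V\<close> is adjoint to right multiplication on
  \<open>W\<close>, which is cyclicity itself.\<close>

lemma canonical_slide_right:
  assumes dual: "dual_bases ip V W B \<gamma>"
    and V: "\<And>v. v \<in> V \<Longrightarrow> d * v \<in> V" and W: "\<And>w. w \<in> W \<Longrightarrow> w * d \<in> W"
  shows "(\<Sum>b\<in>B. (d * b) \<otimes> \<gamma> b) = (\<Sum>b\<in>B. b \<otimes> (\<gamma> b * d))"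
proof -
  have "(\<Sum>b\<in>B. (d * b) \<otimes> \<gamma> b) = (\<Sum>b\<in>B. \<Sum>c\<in>B. ip (d * b) (\<gamma> c) *\<^sub>C (c \<otimes> \<gamma> b))"
    by (intro sum.cong) (simp_all add: dual_bases_sum(1)[OF dual tensor_linear(1)] V dual_bases_mem[OF dual])
  also have "\<dots> = (\<Sum>c\<in>B. \<Sum>b\<in>B. ip b (\<gamma> c * d) *\<^sub>C (c \<otimes> \<gamma> b))"
    unfolding cyclic by (rule sum.swap)
  also have "\<dots> = (\<Sum>c\<in>B. c \<otimes> (\<gamma> c * d))"
    by (intro sum.cong) (simp_all add: dual_bases_sum(2)[OF dual tensor_linear(2)] W dual_bases_mem[OF dual])
  finally show ?thesis .
qed

section \<open>Contraction of a tensor leg\<close>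

definition contract2 :: "'a \<Rightarrow> 'a tensor2 \<Rightarrow> 'a" where
  "contract2 l = tensor_lift (\<lambda>a b. ip b l *\<^sub>C a)"

lemma contract2_pure [simp]: "contract2 l (a \<otimes> b) = ip b l *\<^sub>C a"
  unfolding contract2_def
  by (subst tensor_lift_pure)
    (simp_all add: complex_bilinear_iff scaleC_add_right scaleC_add_left ip_add ip_scaleC mult.commute)

lemma contract2_linear:
  "contract2 l (s + t) = contract2 l s + contract2 l t"
  "contract2 l (c *\<^sub>C t) = c *\<^sub>C contract2 l t" "contract2 l 0 = 0"
  by (simp_all add: contract2_def)

text \<open>The triple power is nested to the left, so the middle factor is the second factor of the
  left component, on which \<open>contract2\<close> acts.\<close>

definition contract_mid :: "'a \<Rightarrow> 'a tensor3 \<Rightarrow> 'a tensor2" where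
  "contract_mid l = tensor_lift (\<lambda>t c. contract2 l t \<otimes> c)"

lemma contract_mid_pure [simp]: "contract_mid l (a \<otimes> b \<otimes> c) = ip b l *\<^sub>C (a \<otimes> c)"
  unfolding contract_mid_def
  by (subst tensor_lift_pure)
    (simp_all add: complex_bilinear_iff contract2_linear tensor_add_left tensor_add_right
      tensor_scaleC_left tensor_scaleC_right)

lemma contract_mid_linear:
  "contract_mid l (s + t) = contract_mid l s + contract_mid l t" "contract_mid l 0 = 0"
  by (simp_all add: contract_mid_def)

lemma contract_mid_sum: "contract_mid l (\<Sum>i\<in>I. f i) = (\<Sum>i\<in>I. contract_mid l (f i))"
  by (induct I rule: infinite_finite_induct) (simp_all add: contract_mid_linear)

lemma tensor3_induct:
  assumes "P 0" "\<And>a b c. P (a \<otimes> b \<otimes> c)" "\<And>u v. P u \<Longrightarrow> P v \<Longrightarrow> P (u + v)"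
  shows "P (t :: 'a tensor3)"
proof (induct t)
  case (pure s c)
  show ?case by (induct s) (use assms in \<open>simp_all add: tensor_add_left\<close>)
qed (use assms in auto)

lemma contract_mid_add: "contract_mid (l + m) t = contract_mid l t + contract_mid m t"
  by (induct t rule: tensor3_induct)
    (simp_all add: contract_mid_linear ip_add scaleC_add_left)

definition insert_mid :: "'a \<Rightarrow> 'a tensor2 \<Rightarrow> 'a tensor3" where
  "insert_mid e = tensor_lift (\<lambda>a c. a \<otimes> e \<otimes> c)"

lemma insert_mid_pure [simp]: "insert_mid e (a \<otimes> c) = a \<otimes> e \<otimes> c"
  unfolding insert_mid_def
  by (subst tensor_lift_pure)
    (simp_all add: complex_bilinear_iff tensor_add_left tensor_add_right
      tensor_scaleC_left tensor_scaleC_right)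

lemma insert_mid_linear:
  "insert_mid l (s + t) = insert_mid l s + insert_mid l t"
  "insert_mid l (c *\<^sub>C t) = c *\<^sub>C insert_mid l t" "insert_mid l 0 = 0"
  by (simp_all add: insert_mid_def)

text \<open>Contractions with a dual basis of the whole algebra are the coordinates in the middle
  factor, and \<open>insert_mid\<close> reassembles the tensor from them.\<close>

lemma tensor3_eqI:
  assumes fin: "finite (X :: 'a set)" "complex_vector.span X = UNIV"
    and eq: "\<And>l. contract_mid l t = contract_mid l u"
  shows "t = u"
proof -
  obtain B \<gamma> where dual: "dual_bases ip UNIV UNIV B \<gamma>"
    using dual_bases_exist[of X UNIV] fin nondegenerate by auto
  have expand: "t = (\<Sum>b\<in>B. insert_mid b (contract_mid (\<gamma> b) t))" for t
  proof (induct t rule: tensor3_induct)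
    case (2 x y z)
    have lin: "complex_linear (\<lambda>y. x \<otimes> y \<otimes> z)"
      by (simp add: complex_linear_iff tensor_add_left tensor_add_right
          tensor_scaleC_left tensor_scaleC_right)
    then show ?case
      by (simp add: insert_mid_linear dual_bases_sum(1)[OF dual lin])
  qed (simp_all add: contract_mid_linear insert_mid_linear sum.distrib)
  show ?thesis
    using trans[OF expand[of t, unfolded eq] expand[of u, symmetric]] .
qed

end

section \<open>The diagonal\<close>

text \<open>Scalars are absorbed into the first factor, as \<open>D\<close> is a subspace; hence
  there is no case for scalar multiples.\<close>

lemma tensor_square_induct [consumes 2, case_names zero pure add]:
  assumes "S \<in> tensor_square D" "complex_vector.subspace D"
    and "P 0" "\<And>a b. a \<in> D \<Longrightarrow> b \<in> D \<Longrightarrow> P (a \<otimes> b)"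
    and "\<And>s t. s \<in> tensor_square D \<Longrightarrow> t \<in> tensor_square D \<Longrightarrow> P s \<Longrightarrow> P t \<Longrightarrow> P (s + t)"
  shows "P S"
proof -
  have "S \<in> tensor_square D \<and> P S"
    using assms(1) unfolding tensor_square_def
  proof (induct rule: complex_vector.span_induct_alt)
    case base
    show ?case using assms(3) by (simp add: complex_vector.span_zero)
  next
    case (step c x y)
    then obtain a b where x: "x = a \<otimes> b" "a \<in> D" "b \<in> D" by blast
    have "c *\<^sub>C x = (c *\<^sub>C a) \<otimes> b" "c *\<^sub>C a \<in> D"
      using x assms(2) by (simp_all add: tensor_scaleC_left complex_vector.subspace_scale)
    then have "P (c *\<^sub>C x)" using assms(4) x by simp
    moreover have "c *\<^sub>C x \<in> complex_vector.span {a \<otimes> b | a b. a \<in> D \<and> b \<in> D}"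
      using step(1) by (intro complex_vector.span_scale complex_vector.span_base)
    ultimately show ?case
      using step(2) assms(5)[of "c *\<^sub>C x" y] unfolding tensor_square_def
      by (simp add: complex_vector.span_add)
  qed
  then show ?thesis ..
qed

lemma tensor_square_pure: "a \<in> D \<Longrightarrow> b \<in> D \<Longrightarrow> a \<otimes> b \<in> tensor_square D"
  unfolding tensor_square_def by (intro complex_vector.span_base) blast

lemma tensor_square_add: "s \<in> tensor_square D \<Longrightarrow> t \<in> tensor_square D \<Longrightarrow> s + t \<in> tensor_square D"
  unfolding tensor_square_def by (rule complex_vector.span_add)

lemma tensor_square_diff: "s \<in> tensor_square D \<Longrightarrow> t \<in> tensor_square D \<Longrightarrow> s - t \<in> tensor_square D"
  unfolding tensor_square_def by (rule complex_vector.span_diff)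

lemma tensor_square_zero: "0 \<in> tensor_square D"
  unfolding tensor_square_def by (rule complex_vector.span_zero)

lemma tensor_square_sum: "(\<And>i. i \<in> I \<Longrightarrow> f i \<in> tensor_square D) \<Longrightarrow> (\<Sum>i\<in>I. f i) \<in> tensor_square D"
  unfolding tensor_square_def by (rule complex_vector.span_sum)

lemma tensor_square_flip:
  fixes D :: "'a::complex_unital_algebra set"
  assumes "S \<in> tensor_square D" "complex_vector.subspace D"
  shows "flip S \<in> tensor_square D"
  using assms
  by (induct rule: tensor_square_induct)
    (simp_all add: leg_add tensor_square_zero tensor_square_pure tensor_square_add)

lemma tensor_square_mult:
  fixes D :: "'a::complex_unital_algebra set"
  assumes "S \<in> tensor_square D" and T: "T \<in> tensor_square D" and D: "is_subalgebra D"
  shows "S * T \<in> tensor_square D"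
proof -
  have sub: "complex_vector.subspace D" using D by (simp add: is_subalgebra_def)
  show ?thesis
    using assms(1) sub
  proof (induct rule: tensor_square_induct)
    case (pure a b)
    show ?case
      using T sub
    proof (induct rule: tensor_square_induct)
      case (pure c d)
      then show ?case using \<open>a \<in> D\<close> \<open>b \<in> D\<close> D
        by (simp add: is_subalgebra_def tensor_square_pure)
    qed (simp_all add: distrib_left tensor_square_zero tensor_square_add)
  qed (simp_all add: distrib_right tensor_square_zero tensor_square_add)
qed

context associative_triple
begin

lemma subspaces:
  "complex_vector.subspace Np" "complex_vector.subspace D" "complex_vector.subspace Nm"
  using subalgebra_Np subalgebra_D subalgebra_Nm by (simp_all add: is_subalgebra_def)

lemma D_orthogonal:
  assumes "d \<in> D"
  shows "x \<in> Np \<Longrightarrow> ip d x = 0" "x \<in> Nm \<Longrightarrow> ip d x = 0"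
    "x \<in> Np \<Longrightarrow> ip x d = 0" "x \<in> Nm \<Longrightarrow> ip x d = 0"
  using orthogonal[OF assms, of 0 x] orthogonal[OF assms, of x 0] symmetric[of x d]
    complex_vector.subspace_0[OF subspaces(1)] complex_vector.subspace_0[OF subspaces(3)]
  by simp_all

lemma triple_decompose:
  obtains x d y where "x \<in> Nm" "d \<in> D" "y \<in> Np" "l = x + d + y"
  using linear_sum by blast

text \<open>Since \<open>D\<close> is orthogonal to \<open>Nm\<close> and \<open>Np\<close>, an
  element of \<open>D\<close> orthogonal to \<open>D\<close> is orthogonal to the whole
  algebra.\<close>

lemma D_dual_bases: "\<exists>B \<gamma>. dual_bases ip D D B \<gamma>"
proof -
  obtain X :: "'a set" where "finite X" "complex_vector.span X = UNIV"
    using finite_dimensional by blast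
  moreover have nondeg: "d = 0" if d: "d \<in> D" and z: "\<And>e. e \<in> D \<Longrightarrow> ip d e = 0" for d
  proof (rule nondegenerate)
    fix l
    obtain x e y where "x \<in> Nm" "e \<in> D" "y \<in> Np" "l = x + e + y"
      by (rule triple_decompose)
    then show "ip d l = 0" using z d by (simp add: ip_add D_orthogonal)
  qed
  ultimately show ?thesis
    by (intro dual_bases_exist[OF _ _ subspaces(2) nondeg]) auto
qed

lemma triple_tensor3_eqI:
  assumes "\<And>l. l \<in> Np \<Longrightarrow> contract_mid l t = contract_mid l u"
    and "\<And>l. l \<in> D \<Longrightarrow> contract_mid l t = contract_mid l u"
    and "\<And>l. l \<in> Nm \<Longrightarrow> contract_mid l t = contract_mid l u"
  shows "t = u"
proof -
  obtain X :: "'a set" where X: "finite X" "complex_vector.span X = UNIV"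
    using finite_dimensional by blast
  show ?thesis
  proof (rule tensor3_eqI[OF X])
    fix l
    obtain x e y where "x \<in> Nm" "e \<in> D" "y \<in> Np" "l = x + e + y"
      by (rule triple_decompose)
    then show "contract_mid l t = contract_mid l u"
      using assms by (simp add: contract_mid_add)
  qed
qed

text \<open>Contracting the Hecke condition with \<open>l \<bottom> D\<close> gives \<open>\<lambda>\<^sup>2 (1, l) 1 = 0\<close>; isotropy follows since
  \<open>(x, y) = (1, x y)\<close>.\<close>

lemma hecke_isotropic:
  assumes S: "S \<in> tensor_square D" and hecke: "hecke_condition ip D S"
  shows "x \<in> Np \<Longrightarrow> y \<in> Np \<Longrightarrow> ip x y = 0" "x \<in> Nm \<Longrightarrow> y \<in> Nm \<Longrightarrow> ip x y = 0"
proof -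
  obtain B \<gamma> where dual: "dual_bases ip D D B \<gamma>" using D_dual_bases by blast
  obtain c where c: "c \<noteq> 0" "flip S * S - permutation ip D * S = c\<^sup>2 *\<^sub>C (1 \<otimes> 1)"
    using hecke unfolding hecke_condition_def by blast
  have "permutation ip D \<in> tensor_square D"
    unfolding permutation_eq[OF bilinear dual]
    using dual_bases_mem[OF dual] by (intro tensor_square_sum tensor_square_pure)
  then have H: "c\<^sup>2 *\<^sub>C (1 \<otimes> 1) \<in> tensor_square D"
    unfolding c(2)[symmetric] using S
    by (intro tensor_square_diff tensor_square_mult tensor_square_flip subalgebra_D subspaces)
  have one: "ip 1 l = 0" if l: "\<And>d. d \<in> D \<Longrightarrow> ip d l = 0" for l
  proof -
    have "contract2 l (c\<^sup>2 *\<^sub>C (1 \<otimes> 1)) = 0"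
      using H subspaces(2)
      by (induct rule: tensor_square_induct) (simp_all add: contract2_linear l)
    then have "ip 1 l = 0 \<or> (1::'a) = 0"
      using c(1) by (simp add: contract2_linear)
    then show ?thesis by (elim disjE) simp_all
  qed
  have iso: "ip x y = 0" if "\<And>d. d \<in> D \<Longrightarrow> ip d (x * y) = 0" for x y
    using one[OF that] ip_assoc[of 1 x y] by simp
  show "ip x y = 0" if "x \<in> Np" "y \<in> Np"
    by (rule iso, rule D_orthogonal(1)) (use that subalgebra_Np in \<open>simp_all add: is_subalgebra_def\<close>)
  show "ip x y = 0" if "x \<in> Nm" "y \<in> Nm"
    by (rule iso, rule D_orthogonal(2)) (use that subalgebra_Nm in \<open>simp_all add: is_subalgebra_def\<close>)
qed

end

section \<open>The canonical element\<close>

text \<open>Serves to place the index whose dual pair is summed away innermost.\<close>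

lemma sum_rotate:
  "(\<Sum>i\<in>I. \<Sum>j\<in>J. \<Sum>k\<in>K. f i j k) = (\<Sum>j\<in>J. \<Sum>k\<in>K. \<Sum>i\<in>I. f i j k)"
  by (subst sum.swap) (intro sum.cong refl sum.swap)

lemma complex_linear_mult_tensor:
  "complex_linear (\<lambda>x. (x * a) \<otimes> c)" "complex_linear (\<lambda>x. (a * x) \<otimes> c)"
  "complex_linear (\<lambda>x. c \<otimes> (x * a))" "complex_linear (\<lambda>x. c \<otimes> (a * x))"
  for a :: "'a::complex_unital_algebra"
  by (simp_all add: complex_linear_iff tensor_add_left tensor_add_right distrib_left distrib_right
      tensor_scaleC_left tensor_scaleC_right)

locale triple_dual_bases = associative_triple ip Mp Mm Np D Nm
  for ip :: "'a::complex_unital_algebra \<Rightarrow> 'a \<Rightarrow> complex" and Mp Mm Np D Nm +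
  fixes A :: "'a set" and \<beta> :: "'a \<Rightarrow> 'a"
  assumes dual_N: "dual_bases ip Np Nm A \<beta>"
begin

definition Q :: "'a tensor2" where
  "Q = (\<Sum>a\<in>A. a \<otimes> \<beta> a)"

lemma basis_mem: "a \<in> A \<Longrightarrow> a \<in> Np" "a \<in> A \<Longrightarrow> \<beta> a \<in> Nm"
  using dual_bases_mem[OF dual_N] by blast+

lemma legs_Q:
  "leg12 Q = (\<Sum>a\<in>A. a \<otimes> \<beta> a \<otimes> 1)" "leg13 Q = (\<Sum>a\<in>A. a \<otimes> 1 \<otimes> \<beta> a)"
  "leg23 Q = (\<Sum>a\<in>A. 1 \<otimes> a \<otimes> \<beta> a)"
  by (simp_all add: Q_def leg_sum)

lemmas expand_N = dual_bases_sum[OF dual_N complex_linear_mult_tensor(1)]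
  dual_bases_sum[OF dual_N complex_linear_mult_tensor(2)]
  dual_bases_sum[OF dual_N complex_linear_mult_tensor(3)]
  dual_bases_sum[OF dual_N complex_linear_mult_tensor(4)]
  dual_bases_sum[OF dual_N tensor_linear(1)]
  dual_bases_sum[OF dual_N tensor_linear(2)]

text \<open>The four cyclic rearrangements are instantiated below so as to isolate the basis vector
  that is summed away.\<close>

lemma ip_move:
  "ip (x * y) z = ip (y * z) x" "ip (x * y) z = ip (z * x) y"
  "ip (x * y) z = ip x (y * z)" "ip (x * y) z = ip y (z * x)"
  by (rule trans[OF ip_assoc symmetric] trans[OF cyclic symmetric] ip_assoc cyclic)+

section \<open>Yang-Baxter equation for the canonical element\<close>

lemma contract_mid_yb_left:
  "contract_mid l (leg12 Q * leg13 Q * leg23 Q) =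
    (\<Sum>i\<in>A. \<Sum>j\<in>A. \<Sum>k\<in>A. ip (\<beta> i * k) l *\<^sub>C ((i * j) \<otimes> (\<beta> j * \<beta> k)))"
  unfolding legs_Q mult.assoc sum_distrib_right
  unfolding sum_distrib_left
  by (simp add: contract_mid_sum)

lemma contract_mid_yb_right:
  "contract_mid l (leg23 Q * leg13 Q * leg12 Q) =
    (\<Sum>k\<in>A. \<Sum>j\<in>A. \<Sum>i\<in>A. ip (k * \<beta> i) l *\<^sub>C ((j * i) \<otimes> (\<beta> k * \<beta> j)))"
  unfolding legs_Q mult.assoc sum_distrib_right
  unfolding sum_distrib_left
  by (simp add: contract_mid_sum)

text \<open>Summing over \<open>i\<close> puts \<open>k * l\<close> in place of \<open>i\<close> on
  the left and \<open>l * k\<close> on the right; up to renaming both sides become the sum of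
  \<open>(k * l * j) \<otimes> (\<beta> j * \<beta> k)\<close>. Stating it through stability of
  \<open>Np\<close> covers \<open>l\<close> in \<open>Np\<close> and in \<open>D\<close> at
  once.\<close>

lemma yb_contract_plus:
  assumes l: "\<And>x. x \<in> Np \<Longrightarrow> x * l \<in> Np" "\<And>x. x \<in> Np \<Longrightarrow> l * x \<in> Np"
  shows "contract_mid l (leg12 Q * leg13 Q * leg23 Q) =
    contract_mid l (leg23 Q * leg13 Q * leg12 Q)"
proof -
  have "contract_mid l (leg12 Q * leg13 Q * leg23 Q) =
      (\<Sum>j\<in>A. \<Sum>k\<in>A. \<Sum>i\<in>A. ip (k * l) (\<beta> i) *\<^sub>C ((i * j) \<otimes> (\<beta> j * \<beta> k)))"
    unfolding contract_mid_yb_left ip_move(1)[of "\<beta> _"] by (rule sum_rotate)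
  also have "\<dots> = (\<Sum>j\<in>A. \<Sum>k\<in>A. (k * l * j) \<otimes> (\<beta> j * \<beta> k))"
    by (simp add: expand_N l basis_mem)
  also have "\<dots> = (\<Sum>k\<in>A. \<Sum>j\<in>A. \<Sum>i\<in>A. ip (l * k) (\<beta> i) *\<^sub>C ((j * i) \<otimes> (\<beta> k * \<beta> j)))"
    by (simp add: expand_N l basis_mem mult.assoc)
  also have "\<dots> = contract_mid l (leg23 Q * leg13 Q * leg12 Q)"
    unfolding contract_mid_yb_right ip_move(2)[of _ "\<beta> _"] ..
  finally show ?thesis .
qed

text \<open>Now the pair in \<open>k\<close> is summed away, and up to renaming the last factor is
  \<open>\<beta> j * l * \<beta> i\<close> on both sides.\<close>

lemma yb_contract_minus:
  assumes l: "\<And>x. x \<in> Nm \<Longrightarrow> x * l \<in> Nm" "\<And>x. x \<in> Nm \<Longrightarrow> l * x \<in> Nm"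
  shows "contract_mid l (leg12 Q * leg13 Q * leg23 Q) =
    contract_mid l (leg23 Q * leg13 Q * leg12 Q)"
proof -
  have "contract_mid l (leg12 Q * leg13 Q * leg23 Q) =
      (\<Sum>i\<in>A. \<Sum>j\<in>A. \<Sum>k\<in>A. ip k (l * \<beta> i) *\<^sub>C ((i * j) \<otimes> (\<beta> j * \<beta> k)))"
    unfolding contract_mid_yb_left ip_move(4)[of "\<beta> _"] ..
  also have "\<dots> = (\<Sum>i\<in>A. \<Sum>j\<in>A. (i * j) \<otimes> (\<beta> j * (l * \<beta> i)))"
    by (simp add: expand_N l basis_mem)
  also have "\<dots> = (\<Sum>j\<in>A. \<Sum>i\<in>A. \<Sum>k\<in>A. ip k (\<beta> i * l) *\<^sub>C ((j * i) \<otimes> (\<beta> k * \<beta> j)))"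
    by (simp add: expand_N l basis_mem mult.assoc)
  also have "\<dots> = contract_mid l (leg23 Q * leg13 Q * leg12 Q)"
    unfolding contract_mid_yb_right ip_move(3)[of _ "\<beta> _"] by (rule sum_rotate[symmetric])
  finally show ?thesis .
qed

lemma yang_baxter_Q: "yang_baxter Q"
  unfolding yang_baxter_def
proof (rule triple_tensor3_eqI)
  show "contract_mid l (leg12 Q * leg13 Q * leg23 Q) =
      contract_mid l (leg23 Q * leg13 Q * leg12 Q)" if "l \<in> Np" for l
    using that subalgebra_Np by (intro yb_contract_plus) (simp_all add: is_subalgebra_def)
  show "contract_mid l (leg12 Q * leg13 Q * leg23 Q) =
      contract_mid l (leg23 Q * leg13 Q * leg12 Q)" if "l \<in> D" for l
    using that bimodule_Np by (intro yb_contract_plus) simp_all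
  show "contract_mid l (leg12 Q * leg13 Q * leg23 Q) =
      contract_mid l (leg23 Q * leg13 Q * leg12 Q)" if "l \<in> Nm" for l
    using that subalgebra_Nm by (intro yb_contract_minus) (simp_all add: is_subalgebra_def)
qed

end

section \<open>Quadratic relations and the Hecke condition\<close>

context triple_dual_bases
begin

section \<open>Moving elements of the diagonal through the canonical element\<close>

lemma Q_slide:
  assumes d: "d \<in> D"
  shows "(\<Sum>a\<in>A. (a * d) \<otimes> \<beta> a) = (\<Sum>a\<in>A. a \<otimes> (d * \<beta> a))"
    and "(\<Sum>a\<in>A. (d * a) \<otimes> \<beta> a) = (\<Sum>a\<in>A. a \<otimes> (\<beta> a * d))"
  by (intro canonical_slide_left[OF dual_N] canonical_slide_right[OF dual_N];
      use d bimodule_Np bimodule_Nm in simp)+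

text \<open>A leg of a pure tensor is a product of two such elements, so \<open>S\<close> can be
  moved through \<open>Q\<close> one factor at a time.\<close>

definition at1 :: "'a \<Rightarrow> 'a tensor3" where "at1 a = a \<otimes> 1 \<otimes> 1"
definition at2 :: "'a \<Rightarrow> 'a tensor3" where "at2 a = 1 \<otimes> a \<otimes> 1"
definition at3 :: "'a \<Rightarrow> 'a tensor3" where "at3 a = 1 \<otimes> 1 \<otimes> a"

lemma leg_at:
  "leg12 (a \<otimes> b) = at1 a * at2 b" "leg13 (a \<otimes> b) = at1 a * at3 b"
  "leg23 (a \<otimes> b) = at2 a * at3 b"
  by (simp_all add: at1_def at2_def at3_def)

lemma at_commute:
  "at2 b * at1 a = at1 a * at2 b" "at3 b * at1 a = at1 a * at3 b" "at3 b * at2 a = at2 a * at3 b"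
  by (simp_all add: at1_def at2_def at3_def)

text \<open>With respect to \<open>D\<close> each leg of \<open>Q\<close> behaves like the
  transposition of its two factors, by the slide identities.\<close>

lemma Q_at:
  assumes d: "d \<in> D"
  shows "leg12 Q * at1 d = at2 d * leg12 Q" "leg12 Q * at2 d = at1 d * leg12 Q"
    "leg12 Q * at3 d = at3 d * leg12 Q"
    "leg13 Q * at1 d = at3 d * leg13 Q" "leg13 Q * at3 d = at1 d * leg13 Q"
    "leg13 Q * at2 d = at2 d * leg13 Q"
    "leg23 Q * at2 d = at3 d * leg23 Q" "leg23 Q * at3 d = at2 d * leg23 Q"
    "leg23 Q * at1 d = at1 d * leg23 Q"
  using arg_cong[where f = leg12, OF Q_slide(1)[OF d]] arg_cong[where f = leg12, OF Q_slide(2)[OF d]]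
    arg_cong[where f = leg13, OF Q_slide(1)[OF d]] arg_cong[where f = leg13, OF Q_slide(2)[OF d]]
    arg_cong[where f = leg23, OF Q_slide(1)[OF d]] arg_cong[where f = leg23, OF Q_slide(2)[OF d]]
  by (simp_all add: legs_Q leg_sum sum_distrib_left sum_distrib_right at1_def at2_def at3_def)

text \<open>Makes a rule for \<open>x * y\<close> applicable inside right-nested products, the
  normal form under \<open>mult.assoc\<close>.\<close>

lemma mult_assoc_left:
  "x * y = z \<Longrightarrow> x * (y * w) = z * w" for x y z w :: "'a tensor3"
  by (simp add: mult.assoc[symmetric])

text \<open>Passing a leg of \<open>Q\<close> transposes its two indices in the leg of
  \<open>S\<close>; \<open>flip\<close> appears where the indices come out in reverse order.\<close>

lemma Q_leg:
  assumes S: "S \<in> tensor_square D"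
  shows "leg12 Q * leg13 S = leg23 S * leg12 Q" (is ?g1)
    and "leg12 Q * leg23 S = leg13 S * leg12 Q" (is ?g2)
    and "leg12 Q * leg12 S = leg12 (flip S) * leg12 Q" (is ?g3)
    and "leg13 Q * leg23 S = leg12 (flip S) * leg13 Q" (is ?g4)
    and "leg13 Q * leg12 S = leg23 (flip S) * leg13 Q" (is ?g5)
    and "leg23 Q * leg13 S = leg12 S * leg23 Q" (is ?g6)
    and "leg23 Q * leg12 S = leg13 S * leg23 Q" (is ?g7)
    and "leg23 Q * leg23 S = leg23 (flip S) * leg23 Q" (is ?g8)
proof -
  have "?g1 \<and> ?g2 \<and> ?g3 \<and> ?g4 \<and> ?g5 \<and> ?g6 \<and> ?g7 \<and> ?g8"
    using S subspaces(2)
  proof (induct rule: tensor_square_induct)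
    case (pure a b)
    note rules = at_commute Q_at[OF pure(1)] Q_at[OF pure(2)]
    show ?case
      unfolding flip_pure leg_at
      by (simp only: mult.assoc rules rules[THEN mult_assoc_left] simp_thms)
  next
    case zero
    show ?case by simp
  next
    case (add s t)
    then show ?case by (simp only: leg_add distrib_left distrib_right simp_thms)
  qed
  then show ?g1 ?g2 ?g3 ?g4 ?g5 ?g6 ?g7 ?g8 by blast+
qed

end

text \<open>Isotropy will be supplied by \<open>hecke_isotropic\<close>; the fixed dual bases of
  \<open>D\<close> turn the permutation into an explicit sum.\<close>

locale isotropic_triple = triple_dual_bases +
  fixes B :: "'a set" and \<gamma> :: "'a \<Rightarrow> 'a"
  assumes isotropic: "\<And>x y. x \<in> Np \<Longrightarrow> y \<in> Np \<Longrightarrow> ip x y = 0"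
      "\<And>x y. x \<in> Nm \<Longrightarrow> y \<in> Nm \<Longrightarrow> ip x y = 0"
    and dual_D: "dual_bases ip D D B \<gamma>"
begin

definition \<sigma> :: "'a tensor2" where
  "\<sigma> = (\<Sum>b\<in>B. b \<otimes> \<gamma> b)"

lemmas expand_D = dual_bases_sum(1)[OF dual_D complex_linear_mult_tensor(1)]
  dual_bases_sum(1)[OF dual_D complex_linear_mult_tensor(2)]

text \<open>The inner index is the one summed away after contraction, except that the first two
  products need the outer one for \<open>l\<close> in \<open>Nm\<close>.\<close>

lemma Q_products:
  "leg12 Q * leg23 Q = (\<Sum>j\<in>A. \<Sum>i\<in>A. i \<otimes> (\<beta> i * j) \<otimes> \<beta> j)"
  "leg23 Q * leg12 Q = (\<Sum>j\<in>A. \<Sum>i\<in>A. i \<otimes> (j * \<beta> i) \<otimes> \<beta> j)"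
  "leg13 Q * leg12 Q = (\<Sum>j\<in>A. \<Sum>i\<in>A. (j * i) \<otimes> \<beta> i \<otimes> \<beta> j)"
  "leg12 Q * leg13 Q = (\<Sum>j\<in>A. \<Sum>i\<in>A. (i * j) \<otimes> \<beta> i \<otimes> \<beta> j)"
  "leg23 Q * leg13 Q = (\<Sum>i\<in>A. \<Sum>j\<in>A. i \<otimes> j \<otimes> (\<beta> j * \<beta> i))"
  "leg13 Q * leg23 Q = (\<Sum>i\<in>A. \<Sum>j\<in>A. i \<otimes> j \<otimes> (\<beta> i * \<beta> j))"
  "leg13 Q * leg12 \<sigma> = (\<Sum>j\<in>A. \<Sum>b\<in>B. (j * b) \<otimes> \<gamma> b \<otimes> \<beta> j)"
  "leg12 \<sigma> * leg13 Q = (\<Sum>j\<in>A. \<Sum>b\<in>B. (b * j) \<otimes> \<gamma> b \<otimes> \<beta> j)"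
  unfolding legs_Q \<sigma>_def leg_sum sum_product leg12_pure tensor_mult_pure mult_1_left mult_1_right
  by (rule refl sum.swap)+

lemma ip_basis:
  "j \<in> A \<Longrightarrow> l \<in> Np \<Longrightarrow> ip j l = 0" "j \<in> A \<Longrightarrow> l \<in> Nm \<Longrightarrow> ip (\<beta> j) l = 0"
  "j \<in> A \<Longrightarrow> l \<in> D \<Longrightarrow> ip j l = 0" "j \<in> A \<Longrightarrow> l \<in> D \<Longrightarrow> ip (\<beta> j) l = 0"
  "b \<in> B \<Longrightarrow> l \<in> Np \<Longrightarrow> ip (\<gamma> b) l = 0" "b \<in> B \<Longrightarrow> l \<in> Nm \<Longrightarrow> ip (\<gamma> b) l = 0"
  using basis_mem isotropic D_orthogonal dual_bases_mem[OF dual_D] by simp_all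

lemma contract_plus_products:
  assumes l: "\<And>x. x \<in> Np \<Longrightarrow> x * l \<in> Np" "\<And>x. x \<in> Np \<Longrightarrow> l * x \<in> Np"
  shows "contract_mid l (leg12 Q * leg23 Q) = (\<Sum>j\<in>A. (j * l) \<otimes> \<beta> j)"
    and "contract_mid l (leg23 Q * leg12 Q) = (\<Sum>j\<in>A. (l * j) \<otimes> \<beta> j)"
proof -
  show "contract_mid l (leg12 Q * leg23 Q) = (\<Sum>j\<in>A. (j * l) \<otimes> \<beta> j)"
    unfolding Q_products contract_mid_sum contract_mid_pure ip_move(1)[of "\<beta> _"]
    by (simp add: expand_N l basis_mem)
  show "contract_mid l (leg23 Q * leg12 Q) = (\<Sum>j\<in>A. (l * j) \<otimes> \<beta> j)"
    unfolding Q_products contract_mid_sum contract_mid_pure ip_move(2)[of _ "\<beta> _"]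
    by (simp add: expand_N l basis_mem)
qed

lemma contract_minus_products:
  assumes l: "\<And>x. x \<in> Nm \<Longrightarrow> x * l \<in> Nm" "\<And>x. x \<in> Nm \<Longrightarrow> l * x \<in> Nm"
  shows "contract_mid l (leg12 Q * leg23 Q) = (\<Sum>i\<in>A. i \<otimes> (l * \<beta> i))"
    and "contract_mid l (leg23 Q * leg12 Q) = (\<Sum>i\<in>A. i \<otimes> (\<beta> i * l))"
  unfolding Q_products contract_mid_sum contract_mid_pure ip_move(4)[of "\<beta> _"]
    ip_move(3)[of _ "\<beta> _"]
  by (subst sum.swap; simp add: expand_N l basis_mem)+

text \<open>On the right the middle factors of the three terms lie in \<open>Nm\<close>,
  \<open>Np\<close> and \<open>D\<close>, in this order. By isotropy and orthogonality only the
  first survives contraction with \<open>l\<close> in \<open>Np\<close>, only the second with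
  \<open>l\<close> in \<open>Nm\<close>, only the third with \<open>l\<close> in
  \<open>D\<close>.\<close>

lemma Q_quadratic:
  "leg12 Q * leg23 Q = leg13 Q * leg12 Q + leg23 Q * leg13 Q + leg13 Q * leg12 \<sigma>" (is ?A)
  "leg23 Q * leg12 Q = leg12 Q * leg13 Q + leg13 Q * leg23 Q + leg12 \<sigma> * leg13 Q" (is ?B)
proof -
  have Np: "x * l \<in> Np" "l * x \<in> Np" if "x \<in> Np" "l \<in> Np" for l x
    using that subalgebra_Np by (simp_all add: is_subalgebra_def)
  have Nm: "x * l \<in> Nm" "l * x \<in> Nm" if "x \<in> Nm" "l \<in> Nm" for l x
    using that subalgebra_Nm by (simp_all add: is_subalgebra_def)
  note sums = contract_mid_linear Q_products contract_mid_sum contract_mid_pure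
  show ?A
  proof (rule triple_tensor3_eqI)
    fix l assume l: "l \<in> Np"
    show "contract_mid l (leg12 Q * leg23 Q) =
      contract_mid l (leg13 Q * leg12 Q + leg23 Q * leg13 Q + leg13 Q * leg12 \<sigma>)"
      \<comment> \<open>The instance of \<open>symmetric\<close> brings the pairing into the form of
        the coefficients in \<open>expand_N\<close>.\<close>
      by (subst contract_plus_products(1)) (simp_all add: sums Np ip_basis l symmetric[of "\<beta> _" l] expand_N)
  next
    fix l assume l: "l \<in> D"
    show "contract_mid l (leg12 Q * leg23 Q) =
      contract_mid l (leg13 Q * leg12 Q + leg23 Q * leg13 Q + leg13 Q * leg12 \<sigma>)"
      by (subst contract_plus_products(1)) (simp_all add: sums bimodule_Np ip_basis l symmetric[of "\<gamma> _" l] expand_D)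
  next
    fix l assume l: "l \<in> Nm"
    show "contract_mid l (leg12 Q * leg23 Q) =
      contract_mid l (leg13 Q * leg12 Q + leg23 Q * leg13 Q + leg13 Q * leg12 \<sigma>)"
      by (subst contract_minus_products(1)) (simp_all add: sums ip_basis l expand_N Nm basis_mem)
  qed
  show ?B
  proof (rule triple_tensor3_eqI)
    fix l assume l: "l \<in> Np"
    show "contract_mid l (leg23 Q * leg12 Q) =
      contract_mid l (leg12 Q * leg13 Q + leg13 Q * leg23 Q + leg12 \<sigma> * leg13 Q)"
      by (subst contract_plus_products(2)) (simp_all add: sums Np ip_basis l symmetric[of "\<beta> _" l] expand_N)
  next
    fix l assume l: "l \<in> D"
    show "contract_mid l (leg23 Q * leg12 Q) =
      contract_mid l (leg12 Q * leg13 Q + leg13 Q * leg23 Q + leg12 \<sigma> * leg13 Q)"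
      by (subst contract_plus_products(2)) (simp_all add: sums bimodule_Np ip_basis l symmetric[of "\<gamma> _" l] expand_D)
  next
    fix l assume l: "l \<in> Nm"
    show "contract_mid l (leg23 Q * leg12 Q) =
      contract_mid l (leg12 Q * leg13 Q + leg13 Q * leg23 Q + leg12 \<sigma> * leg13 Q)"
      by (subst contract_minus_products(2)) (simp_all add: sums ip_basis l expand_N Nm basis_mem)
  qed
qed

section \<open>The permutation of the diagonal and the equation for \<open>S + Q\<close>\<close>

lemma sigma_D: "\<sigma> \<in> tensor_square D"
  unfolding \<sigma>_def using dual_bases_mem[OF dual_D] by (intro tensor_square_sum tensor_square_pure)

text \<open>In the basis \<open>B\<close> the coefficients of \<sigma> are the Gram matrix of the
  dual basis, which is symmetric.\<close>

lemma flip_sigma: "flip \<sigma> = \<sigma>"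
proof -
  have "flip \<sigma> = (\<Sum>b\<in>B. \<Sum>c\<in>B. ip (\<gamma> b) (\<gamma> c) *\<^sub>C (c \<otimes> b))"
    using dual_bases_mem[OF dual_D]
    by (simp add: \<sigma>_def leg_sum dual_bases_sum(1)[OF dual_D tensor_linear(1)])
  also have "\<dots> = (\<Sum>c\<in>B. \<Sum>b\<in>B. ip (\<gamma> c) (\<gamma> b) *\<^sub>C (c \<otimes> b))"
    by (subst sum.swap) (simp only: symmetric)
  also have "\<dots> = \<sigma>"
    using dual_bases_mem[OF dual_D]
    by (simp add: \<sigma>_def dual_bases_sum(1)[OF dual_D tensor_linear(2)])
  finally show ?thesis .
qed

text \<open>The slide identities with \<open>V = W = D\<close> show that \<sigma> exchanges the two
  factors of whatever passes through it.\<close>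

lemma sigma_flip:
  assumes "S \<in> tensor_square D"
  shows "\<sigma> * flip S = S * \<sigma>"
  using assms subspaces(2)
proof (induct rule: tensor_square_induct)
  case (pure a b)
  have mult: "x * y \<in> D" if "x \<in> D" "y \<in> D" for x y
    using that subalgebra_D by (simp add: is_subalgebra_def)
  have 1: "\<sigma> * (b \<otimes> 1) = (1 \<otimes> b) * \<sigma>"
    using canonical_slide_left[OF dual_D, of b] pure mult
    by (simp add: \<sigma>_def sum_distrib_left sum_distrib_right)
  have 2: "\<sigma> * (1 \<otimes> a) = (a \<otimes> 1) * \<sigma>"
    using canonical_slide_right[OF dual_D, of a] pure mult
    by (simp add: \<sigma>_def sum_distrib_left sum_distrib_right)
  have "\<sigma> * flip (a \<otimes> b) = \<sigma> * (b \<otimes> 1) * (1 \<otimes> a)"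
    by (simp add: mult.assoc)
  also have "\<dots> = (1 \<otimes> b) * ((a \<otimes> 1) * \<sigma>)"
    unfolding 1 mult.assoc 2 ..
  also have "\<dots> = (a \<otimes> b) * \<sigma>"
    by (simp add: mult.assoc[symmetric])
  finally show ?case .
qed (simp_all add: leg_add distrib_left distrib_right)

lemma yang_baxter_hecke:
  assumes S: "S \<in> tensor_square D" and yb: "yang_baxter S"
    and hecke: "flip S * S - \<sigma> * S = c *\<^sub>C (1 \<otimes> 1)"
  shows "yang_baxter (S + Q)"
proof -
  have S': "flip S \<in> tensor_square D"
    using tensor_square_flip[OF S subspaces(2)] .
  \<comment> \<open>\<open>flip S\<close> needs rules of its own: it arises when \<open>S\<close>
    passes \<open>leg13 Q\<close>, and must then pass \<open>leg12 Q\<close> or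
    \<open>leg23 Q\<close>.\<close>
  note move = Q_leg[OF S] Q_leg[OF S', unfolded flip_flip]
    Q_leg(5)[OF sigma_D, unfolded flip_sigma]
  \<comment> \<open>The expansion will produce \<open>S * flip S\<close>, so the Hecke condition is
    flipped.\<close>
  have "flip (flip S * S) = flip (c *\<^sub>C (1 \<otimes> 1) + \<sigma> * S)"
    using hecke by (simp add: algebra_simps)
  then have H: "S * flip S = c *\<^sub>C (1 \<otimes> 1) + S * \<sigma>"
    by (simp add: flip_mult leg_add leg_scaleC flip_sigma sigma_flip[OF S])
  have "leg12 S * leg12 (flip S) = c *\<^sub>C 1 + leg12 S * leg12 \<sigma>"
    using arg_cong[where f = leg12, OF H] by (simp only: leg12_mult leg_add leg_scaleC leg_one)
  moreover have "leg23 S * leg23 (flip S) = c *\<^sub>C 1 + leg23 S * leg23 \<sigma>"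
    using arg_cong[where f = leg23, OF H] by (simp only: leg23_mult leg_add leg_scaleC leg_one)
  \<comment> \<open>Comparing the two legs eliminates the scalar \<open>c\<close>.\<close>
  ultimately have "(leg12 S * leg12 (flip S) + leg23 S * leg23 \<sigma>) * leg13 Q =
      (leg23 S * leg23 (flip S) + leg12 S * leg12 \<sigma>) * leg13 Q"
    by (simp add: algebra_simps)
  then have cancel: "leg12 S * (leg12 (flip S) * leg13 Q) + leg23 S * (leg23 \<sigma> * leg13 Q) =
      leg23 S * (leg23 (flip S) * leg13 Q) + leg12 S * (leg12 \<sigma> * leg13 Q)"
    unfolding distrib_right mult.assoc .
  \<comment> \<open>The eight terms common to both sides once every \<open>S\<close> stands to the
    left of every \<open>Q\<close>; the two remaining terms on each side are those of
    \<open>cancel\<close>.\<close>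
  define T where "T = leg12 S * (leg13 S * leg23 S) + leg12 Q * (leg13 Q * leg23 Q) +
    leg12 S * (leg13 S * leg23 Q) + leg23 S * (leg13 S * leg12 Q) +
    leg12 S * (leg13 Q * leg23 Q) + leg12 S * (leg12 Q * leg13 Q) +
    leg23 S * (leg13 Q * leg12 Q) + leg23 S * (leg23 Q * leg13 Q)"
  have "leg12 (S + Q) * leg13 (S + Q) * leg23 (S + Q) =
      T + (leg12 S * (leg12 (flip S) * leg13 Q) + leg23 S * (leg23 \<sigma> * leg13 Q))"
    unfolding T_def leg_add distrib_left distrib_right mult.assoc
    by (simp only: move move[THEN mult_assoc_left] Q_quadratic distrib_left mult.assoc add_ac)
  also have "\<dots> = T + (leg23 S * (leg23 (flip S) * leg13 Q) + leg12 S * (leg12 \<sigma> * leg13 Q))"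
    unfolding cancel ..
  also have "\<dots> = leg23 (S + Q) * leg13 (S + Q) * leg12 (S + Q)"
    unfolding T_def leg_add distrib_left distrib_right mult.assoc
    by (simp only: move move[THEN mult_assoc_left] Q_quadratic distrib_left mult.assoc add_ac
        yb[unfolded yang_baxter_def mult.assoc] yang_baxter_Q[unfolded yang_baxter_def mult.assoc])
  finally show ?thesis unfolding yang_baxter_def .
qed

end

theorem theorem1:
  fixes ip :: "'m::complex_unital_algebra \<Rightarrow> 'm \<Rightarrow> complex"
    and Mp Mm Np D Nm A :: "'m set"
    and \<beta> :: "'m \<Rightarrow> 'm"
    and Q :: "'m tensor2"
  assumes triple: "associative_triple ip Mp Mm Np D Nm"
    and bases: "dual_bases ip Np Nm A \<beta>"
    and Q: "Q = (\<Sum>\<alpha>\<in>A. \<alpha> \<otimes> \<beta> \<alpha>)"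
  shows "yang_baxter Q \<and>
    (\<forall>S\<in>tensor_square D. yang_baxter S \<and> hecke_condition ip D S \<longrightarrow> yang_baxter (S + Q))"
proof -
  interpret associative_triple ip Mp Mm Np D Nm by (rule triple)
  interpret T: triple_dual_bases ip Mp Mm Np D Nm A \<beta>
    by unfold_locales (rule bases)
  have Q_eq: "Q = T.Q"
    unfolding Q T.Q_def ..
  obtain B \<gamma> where dual: "dual_bases ip D D B \<gamma>"
    using D_dual_bases by blast
  have "yang_baxter (S + T.Q)"
    if S: "S \<in> tensor_square D" "yang_baxter S" and hecke: "hecke_condition ip D S" for S
  proof -
    \<comment> \<open>The nonvanishing of the Hecke scalar enters here, through
      \<open>hecke_isotropic\<close>.\<close>
    interpret H: isotropic_triple ip Mp Mm Np D Nm A \<beta> B \<gamma>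
      by unfold_locales (rule hecke_isotropic[OF S(1) hecke] dual; assumption)+
    obtain c where "flip S * S - permutation ip D * S = c\<^sup>2 *\<^sub>C (1 \<otimes> 1)"
      using hecke unfolding hecke_condition_def by blast
    then have "flip S * S - H.\<sigma> * S = c\<^sup>2 *\<^sub>C (1 \<otimes> 1)"
      by (simp only: permutation_eq[OF bilinear dual] H.\<sigma>_def)
    then show ?thesis
      by (rule H.yang_baxter_hecke[OF S])
  qed
  then show ?thesis
    unfolding Q_eq using T.yang_baxter_Q by blast
qed

end
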